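(* Let $D\subset\mathbb{C}^{n}$ be a $\mathcal{C}^{1}$-smooth pseudoconvex Reinhardt domain. Fix $z_{0}\in D$ and $\zeta_{0}\in\partial D$. Then, for some constant $C$, the inequality $$k_{D}(z_{0},z)\geq-\frac{1}{2}\log d_{D}(z)+C$$ holds if $z\in D$ tends non-tangentially to $\zeta_{0}$. That is: for every cone $\mathcal{A}\subset\mathbb{C}^n\cong\mathbb{R}^{2n}$ with vertex $\zeta_0$, semi-axis $-\nu_D(\zeta_0)$ and angle $\alpha\in(0,\frac{\pi}{2})$, and every open neighbourhood $U\subset\mathbb{C}^n$ of $\zeta_0$ with $U\cap\mathcal{A}\subset D$, there exist a constant $C\in\mathbb{R}$ and an open neighbourhood $U'\subset U$ of $\zeta_0$ such that the inequality holds for all $z\in U'\cap\mathcal{A}$.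
   Context: A domain is a non-empty connected open set. A domain $D\subset\mathbb{C}^n$ is a Reinhardt domain if $(\lambda_{1}z_{1},\ldots,\lambda_{n}z_{n})\in D$ for all $z\in D$ and all $\lambda_1,\ldots,\lambda_n\in\mathbb{C}$ with $|\lambda_j|=1$. For $z\in D$, $d_D(z)$ denotes the Euclidean distance from $z$ to $\partial D$. A domain $D\subset\mathbb{C}^n$ is $\mathcal{C}^{1}$-smooth if for every $\zeta_0\in\partial D$ there exist an open neighbourhood $U\subset\mathbb{C}^n$ of $\zeta_0$ and a $\mathcal{C}^1$-smooth function $\rho:U\to\mathbb{R}$ (a local defining function for $D$ at $\zeta_0$) such that (1) $U\cap D=\{z\in U:\rho(z)<0\}$; (2) $U\setminus\overline{D}=\{z\in U:\rho(z)>0\}\neq\emptyset$; (3) $\nabla\rho:=\left(\frac{\partial\rho}{\partial\overline{z}_1},\ldots,\frac{\partial\rho}{\partial\overline{z}_n}\right)\neq0$ on $U$. The normal vector to $\partial D$ at $\zeta_0$ is $\nu_D(\zeta_0):=\nabla\rho(\zeta_0)/\|\nabla\rho(\zeta_0)\|$ (the outward unit normal). The cone in $\mathbb{R}^m$ with vertex $x_0\in\mathbb{R}^m$, semi-axis $\nu\in\mathbb{R}^m\setminus\{0\}$ and angle $\alpha\in(0,\frac{\pi}{2})$ is the set of all $x\in\mathbb{R}^m\setminus\{x_0\}$ such that the angle between $\nu$ and $x-x_0$ does not exceed $\alpha$. A point $z\in D$ tends non-tangentially to $\zeta_0\in\partial D$ if there exist a cone $\mathcal{A}\subset\mathbb{C}^n\cong\mathbb{R}^{2n}$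 with vertex $\zeta_0$, semi-axis $-\nu_D(\zeta_0)$ and angle $\alpha\in(0,\frac\pi2)$, and an open neighbourhood $U$ of $\zeta_0$, such that $U\cap\mathcal{A}\subset D$ and $z$ tends to $\zeta_0$ within $U\cap\mathcal{A}$. Let $\mathbb{D}\subset\mathbb{C}$ be the unit disc and $p$ the Poincaré distance on $\mathbb{D}$, normalized by $p(\lambda,\mu)=\tanh^{-1}\left|\frac{\lambda-\mu}{1-\overline{\mu}\lambda}\right|$, so that $p(0,\lambda)=\frac12\log\frac{1+|\lambda|}{1-|\lambda|}$. The Lempert function of $D$ is $$\widetilde{k}_{D}(w,z):=\inf\{p(\lambda,\mu):\lambda,\mu\in\mathbb{D}\text{ and there is a holomorphic } f:\mathbb{D}\to D \text{ with } f(\lambda)=w,\ f(\mu)=z\}.$$ The Kobayashi (pseudo)distance $k_D$ is the largest pseudodistance on $D$ that is less than or equal to $\widetilde{k}_D$; equivalently, $k_D(w,z)$ is the infimum of $\sum_{j=1}^{N}\widetilde{k}_D(w_{j-1},w_j)$ over all $N\geq 1$ and all finite chains $w=w_0,w_1,\ldots,w_N=z$ in $D$. *)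

theory Defs
  imports "HOL-Analysis.Analysis"
begin

section \<open>Domains in complex Euclidean space\<close>

definition is_domain :: "(complex ^ 'n) set \<Rightarrow> bool" where
  "is_domain D \<longleftrightarrow> open D \<and> connected D \<and> D \<noteq> {}"

definition reinhardt_domain :: "(complex ^ 'n) set \<Rightarrow> bool" where
  "reinhardt_domain D \<longleftrightarrow> is_domain D \<and>
     (\<forall>z\<in>D. \<forall>l :: complex ^ 'n. (\<forall>j. cmod (l $ j) = 1) \<longrightarrow> (\<chi> j. l $ j * z $ j) \<in> D)"

abbreviation dist_bdry :: "(complex ^ 'n) set \<Rightarrow> complex ^ 'n \<Rightarrow> real" where
  "dist_bdry D z \<equiv> infdist z (frontier D)"


section \<open>Smooth boundaries and the outward unit normal\<close>

definition C1_fun_on :: "('a::real_normed_vector \<Rightarrow> real) \<Rightarrow> 'a set \<Rightarrow> bool" where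
  "C1_fun_on \<rho> U \<longleftrightarrow>
     (\<exists>\<rho>' :: 'a \<Rightarrow> 'a \<Rightarrow>\<^sub>L real.
        (\<forall>z\<in>U. (\<rho> has_derivative blinfun_apply (\<rho>' z)) (at z)) \<and> continuous_on U \<rho>')"

text \<open>The vector of Wirtinger derivatives with respect to the conjugate variables, that is, with
  components \<open>(1/2) (\<partial>\<rho>/\<partial>x\<^sub>j + \<i> \<partial>\<rho>/\<partial>y\<^sub>j)\<close> for \<open>z\<^sub>j = x\<^sub>j + \<i> y\<^sub>j\<close>.\<close>

definition grad_bar :: "(complex ^ 'n \<Rightarrow> real) \<Rightarrow> complex ^ 'n \<Rightarrow> complex ^ 'n" where
  "grad_bar \<rho> z = (\<chi> j. (1 / 2) *
     (complex_of_real (frechet_derivative \<rho> (at z) (axis j 1)) +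
      \<i> * complex_of_real (frechet_derivative \<rho> (at z) (axis j \<i>))))"

definition local_defining_fun ::
    "(complex ^ 'n) set \<Rightarrow> complex ^ 'n \<Rightarrow> (complex ^ 'n) set \<Rightarrow> (complex ^ 'n \<Rightarrow> real) \<Rightarrow> bool" where
  "local_defining_fun D \<zeta> U \<rho> \<longleftrightarrow>
     open U \<and> \<zeta> \<in> U \<and> C1_fun_on \<rho> U \<and>
     U \<inter> D = {z \<in> U. \<rho> z < 0} \<and>
     U - closure D = {z \<in> U. \<rho> z > 0} \<and> U - closure D \<noteq> {} \<and>
     (\<forall>z\<in>U. grad_bar \<rho> z \<noteq> 0)"

definition C1_smooth_domain :: "(complex ^ 'n) set \<Rightarrow> bool" where
  "C1_smooth_domain D \<longleftrightarrow> is_domain D \<and> (\<forall>\<zeta>\<in>frontier D. \<exists>U \<rho>. local_defining_fun D \<zeta> U \<rho>)"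

definition unit_normal :: "(complex ^ 'n) set \<Rightarrow> complex ^ 'n \<Rightarrow> complex ^ 'n" where
  "unit_normal D \<zeta> =
     (THE \<nu>. \<exists>U \<rho>. local_defining_fun D \<zeta> U \<rho> \<and> \<nu> = grad_bar \<rho> \<zeta> /\<^sub>R norm (grad_bar \<rho> \<zeta>))"

text \<open>The definite description is justified: the normalised gradient does not depend on the
  defining function.\<close>

lemma frechet_derivative_grad_bar:
  fixes \<rho> :: "complex ^ 'n \<Rightarrow> real"
  assumes "\<rho> differentiable (at z)"
  shows "frechet_derivative \<rho> (at z) h = 2 * (grad_bar \<rho> z \<bullet> h)"
proof -
  let ?f = "frechet_derivative \<rho> (at z)"
  have lin: "linear ?f"
    using assms by (rule linear_frechet_derivative)
  have "(\<Sum>j\<in>UNIV. Re (h $ j) *\<^sub>R axis j 1 + Im (h $ j) *\<^sub>R axis j \<i>) = h"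
    by (simp add: vec_eq_iff axis_def if_distrib sum.delta' sum.distrib complex_eq_iff cong: if_cong)
  then have "?f h = ?f (\<Sum>j\<in>UNIV. Re (h $ j) *\<^sub>R axis j 1 + Im (h $ j) *\<^sub>R axis j \<i>)"
    by (rule arg_cong[OF sym])
  also have "\<dots> = (\<Sum>j\<in>UNIV. Re (h $ j) * ?f (axis j 1) + Im (h $ j) * ?f (axis j \<i>))"
    by (simp add: linear_sum[OF lin] linear_add[OF lin] linear_cmul[OF lin])
  also have "\<dots> = 2 * (grad_bar \<rho> z \<bullet> h)"
    by (simp add: inner_vec_def grad_bar_def inner_complex_def sum_distrib_left algebra_simps)
  finally show ?thesis .
qed

lemma local_defining_fun_line_derivative:
  assumes "local_defining_fun D \<zeta> U \<rho>"
  shows "((\<lambda>t. \<rho> (\<zeta> + t *\<^sub>R v)) has_real_derivative 2 * (grad_bar \<rho> \<zeta> \<bullet> v)) (at 0)"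
proof -
  have d: "\<rho> differentiable (at \<zeta>)"
    using assms unfolding local_defining_fun_def C1_fun_on_def differentiable_def by blast
  have "((\<lambda>t. \<rho> (\<zeta> + t *\<^sub>R v)) has_derivative
      (\<lambda>t. frechet_derivative \<rho> (at \<zeta>) (t *\<^sub>R v))) (at 0)"
  proof (rule has_derivative_compose[where f = "\<lambda>t. \<zeta> + t *\<^sub>R v"])
    show "((\<lambda>t. \<zeta> + t *\<^sub>R v) has_derivative (\<lambda>t. t *\<^sub>R v)) (at 0)"
      by (auto intro!: derivative_eq_intros)
    show "(\<rho> has_derivative frechet_derivative \<rho> (at \<zeta>)) (at (\<zeta> + 0 *\<^sub>R v))"
      using d by (simp add: frechet_derivative_works)
  qed
  then show ?thesis
    by (simp add: frechet_derivative_grad_bar[OF d] has_field_derivative_def mult.left_commute mult_commute_abs)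
qed

lemma local_defining_fun_zero:
  assumes "local_defining_fun D \<zeta> U \<rho>" "open D" "\<zeta> \<in> frontier D"
  shows "\<rho> \<zeta> = 0"
proof -
  have "\<zeta> \<in> U" "U \<inter> D = {z \<in> U. \<rho> z < 0}" "U - closure D = {z \<in> U. \<rho> z > 0}"
    using assms(1) by (simp_all add: local_defining_fun_def)
  moreover have "\<zeta> \<notin> D" "\<zeta> \<in> closure D"
    using assms(2,3) by (simp_all add: frontier_def interior_open)
  ultimately have "\<not> \<rho> \<zeta> < 0" "\<not> \<rho> \<zeta> > 0"
    by blast+
  then show ?thesis
    by linarith
qed

lemma unit_normal_eq:
  assumes "local_defining_fun D \<zeta> U \<rho>" and D: "open D" "\<zeta> \<in> frontier D"
  shows "unit_normal D \<zeta> = grad_bar \<rho> \<zeta> /\<^sub>R norm (grad_bar \<rho> \<zeta>)"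
proof -
  have "\<nu> = \<nu>'"
    if 1: "local_defining_fun D \<zeta> U1 \<rho>1" "\<nu> = grad_bar \<rho>1 \<zeta> /\<^sub>R norm (grad_bar \<rho>1 \<zeta>)"
      and 2: "local_defining_fun D \<zeta> U2 \<rho>2" "\<nu>' = grad_bar \<rho>2 \<zeta> /\<^sub>R norm (grad_bar \<rho>2 \<zeta>)"
    for \<nu> \<nu>' U1 U2 \<rho>1 \<rho>2
  proof (rule ccontr)
    assume ne: "\<nu> \<noteq> \<nu>'"
    have g: "grad_bar \<rho>1 \<zeta> \<noteq> 0" "grad_bar \<rho>2 \<zeta> \<noteq> 0"
      using 1 2 by (auto simp: local_defining_fun_def)
    then have n: "norm \<nu> = 1" "norm \<nu>' = 1"
      using 1 2 by auto
    then have nn: "\<nu> \<bullet> \<nu> = 1" "\<nu>' \<bullet> \<nu>' = 1"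
      by (simp_all add: dot_square_norm)
    have "(\<nu> - \<nu>') \<bullet> (\<nu> - \<nu>') > 0"
      using ne by simp
    then have lt: "\<nu> \<bullet> \<nu>' < 1"
      using nn by (simp add: inner_diff_left inner_diff_right inner_commute)
    let ?v = "\<nu>' - \<nu>"
    have s1: "grad_bar \<rho>1 \<zeta> \<bullet> x = norm (grad_bar \<rho>1 \<zeta>) * (\<nu> \<bullet> x)" for x
      using g by (simp add: 1(2))
    have s2: "grad_bar \<rho>2 \<zeta> \<bullet> x = norm (grad_bar \<rho>2 \<zeta>) * (\<nu>' \<bullet> x)" for x
      using g by (simp add: 2(2))
    have "\<nu> \<bullet> ?v < 0" "\<nu>' \<bullet> ?v > 0"
      using lt nn by (simp_all add: inner_diff_right inner_commute)
    then have s: "grad_bar \<rho>1 \<zeta> \<bullet> ?v < 0" "grad_bar \<rho>2 \<zeta> \<bullet> ?v > 0"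
      using g unfolding s1 s2 by (simp_all add: mult_pos_neg)
    have z: "\<rho>1 \<zeta> = 0" "\<rho>2 \<zeta> = 0"
      using local_defining_fun_zero 1 2 D by blast+
    obtain d1 where d1: "d1 > 0" "\<And>t. 0 < t \<Longrightarrow> t < d1 \<Longrightarrow> \<rho>1 (\<zeta> + t *\<^sub>R ?v) < 0"
      using DERIV_neg_dec_right[OF local_defining_fun_line_derivative[OF 1(1), of ?v]] s z by auto
    obtain d2 where d2: "d2 > 0" "\<And>t. 0 < t \<Longrightarrow> t < d2 \<Longrightarrow> \<rho>2 (\<zeta> + t *\<^sub>R ?v) > 0"
      using DERIV_pos_inc_right[OF local_defining_fun_line_derivative[OF 2(1), of ?v]] s z by auto
    have U: "open (U1 \<inter> U2)" "\<zeta> \<in> U1 \<inter> U2"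
      using 1 2 by (auto simp: local_defining_fun_def)
    have "((\<lambda>t. \<zeta> + t *\<^sub>R ?v) \<longlongrightarrow> \<zeta> + 0 *\<^sub>R ?v) (at_right 0)"
      by (intro tendsto_intros)
    then have "\<forall>\<^sub>F t in at_right 0. \<zeta> + t *\<^sub>R ?v \<in> U1 \<inter> U2"
      using topological_tendstoD U by fastforce
    moreover have "\<forall>\<^sub>F t in at_right 0. t \<in> {0<..<min d1 d2}"
      using d1 d2 by (intro eventually_at_right_real) auto
    ultimately have "\<forall>\<^sub>F t in at_right 0. \<zeta> + t *\<^sub>R ?v \<in> U1 \<inter> U2 \<and> t \<in> {0<..<min d1 d2}"
      by (rule eventually_conj)
    then obtain t :: real where "\<zeta> + t *\<^sub>R ?v \<in> U1 \<inter> U2" "t \<in> {0<..<min d1 d2}"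
      using eventually_happens' trivial_limit_at_right_real by blast
    with d1 d2 have "\<zeta> + t *\<^sub>R ?v \<in> {x \<in> U1. \<rho>1 x < 0}" "\<zeta> + t *\<^sub>R ?v \<in> {x \<in> U2. \<rho>2 x > 0}"
      by auto
    then have "\<zeta> + t *\<^sub>R ?v \<in> D" "\<zeta> + t *\<^sub>R ?v \<notin> closure D"
      using 1 2 unfolding local_defining_fun_def by blast+
    then show False
      using closure_subset by blast
  qed
  then show ?thesis
    unfolding unit_normal_def using assms(1) by (intro the_equality) blast+
qed


section \<open>Cones\<close>

text \<open>\<open>\<nu> \<bullet> (x - x0)\<close> is the real inner product, so the angle is the one in the underlying
  real Euclidean space (of dimension \<open>2n\<close> for \<open>'a = complex ^ 'n\<close>).\<close>

definition cone_at :: "'a::real_inner \<Rightarrow> 'a \<Rightarrow> real \<Rightarrow> 'a set" where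
  "cone_at x0 \<nu> \<alpha> =
     {x. x \<noteq> x0 \<and> arccos ((\<nu> \<bullet> (x - x0)) / (norm \<nu> * norm (x - x0))) \<le> \<alpha>}"


section \<open>Pseudoconvexity\<close>

definition usc_on :: "'a::topological_space set \<Rightarrow> ('a \<Rightarrow> real) \<Rightarrow> bool" where
  "usc_on S u \<longleftrightarrow> (\<forall>c. openin (top_of_set S) {x \<in> S. u x < c})"

text \<open>Only real-valued (pluri)subharmonic functions are needed. For these the integral over a
  circle contained in \<open>S\<close> together with its disc is finite; integrability is required explicitly
  because \<^const>\<open>integral\<close> is \<open>0\<close> for non-integrable functions.\<close>

definition subharmonic_on :: "complex set \<Rightarrow> (complex \<Rightarrow> real) \<Rightarrow> bool" where
  "subharmonic_on S u \<longleftrightarrow> usc_on S u \<and>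
     (\<forall>c r. r > 0 \<and> cball c r \<subseteq> S \<longrightarrow>
        (\<lambda>t. u (c + of_real r * cis t)) integrable_on {0..2 * pi} \<and>
        u c \<le> 1 / (2 * pi) * integral {0..2 * pi} (\<lambda>t. u (c + of_real r * cis t)))"

definition plurisubharmonic_on :: "(complex ^ 'n) set \<Rightarrow> (complex ^ 'n \<Rightarrow> real) \<Rightarrow> bool" where
  "plurisubharmonic_on D u \<longleftrightarrow> usc_on D u \<and>
     (\<forall>a\<in>D. \<forall>b. subharmonic_on {l. a + l *s b \<in> D} (\<lambda>l. u (a + l *s b)))"

text \<open>The case \<open>D = UNIV\<close>, where the distance to the boundary is infinite, needs no special
  treatment: there \<^const>\<open>infdist\<close> and \<^const>\<open>ln\<close> return \<open>0\<close>, so that the whole space is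
  pseudoconvex, as it should be.\<close>

definition pseudoconvex :: "(complex ^ 'n) set \<Rightarrow> bool" where
  "pseudoconvex D \<longleftrightarrow> is_domain D \<and> plurisubharmonic_on D (\<lambda>z. - ln (dist_bdry D z))"


section \<open>The Lempert function and the Kobayashi pseudodistance\<close>

definition poincare_dist :: "complex \<Rightarrow> complex \<Rightarrow> real" where
  "poincare_dist l m = artanh (cmod ((l - m) / (1 - cnj m * l)))"

definition holomorphic_discs :: "(complex ^ 'n) set \<Rightarrow> (complex \<Rightarrow> complex ^ 'n) set" where
  "holomorphic_discs D =
     {f. (\<forall>j. (\<lambda>l. f l $ j) holomorphic_on ball 0 1) \<and> f ` ball 0 1 \<subseteq> D}"

text \<open>Values in \<^typ>\<open>ereal\<close> give the infimum of the empty set its usual value \<open>\<infinity>\<close>.\<close>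

definition lempert :: "(complex ^ 'n) set \<Rightarrow> complex ^ 'n \<Rightarrow> complex ^ 'n \<Rightarrow> ereal" where
  "lempert D w z =
     Inf {ereal (poincare_dist l m) | l m. l \<in> ball 0 1 \<and> m \<in> ball 0 1 \<and>
            (\<exists>f \<in> holomorphic_discs D. f l = w \<and> f m = z)}"

definition kobayashi :: "(complex ^ 'n) set \<Rightarrow> complex ^ 'n \<Rightarrow> complex ^ 'n \<Rightarrow> ereal" where
  "kobayashi D w z =
     Inf {(\<Sum>j<N. lempert D (c j) (c (Suc j))) | N c.
            1 \<le> N \<and> c 0 = w \<and> c N = z \<and> (\<forall>j\<le>N. c j \<in> D)}"

end

theory Submission
  imports Defs "HOL-Complex_Analysis.Riemann_Mapping"
begin

text \<open>In logarithmic coordinates \<open>x\<^sub>j = ln \<bar>z\<^sub>j\<bar>\<close> pseudoconvexity makes the domain convex, because \<open>- ln\<close> of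
  the boundary distance is quasiconvex there and blows up at the boundary. A supporting
  hyperplane at \<open>\<zeta>\<close> gives real exponents \<open>a\<^sub>j\<close> with \<open>\<phi>(z) = \<Prod>\<^sub>j \<bar>z\<^sub>j/\<zeta>\<^sub>j\<bar> powr a\<^sub>j < 1\<close> on \<open>D\<close> and \<open>\<phi>(\<zeta>) = 1\<close>. At
  a boundary point with vanishing coordinates the normal has no component in these coordinates, so
  \<open>D\<close> contains points near \<open>\<zeta>\<close> with the same vanishing coordinates, and this forces \<open>a\<^sub>j = 0\<close> for them.

  Although \<open>\<phi>\<close> is not the modulus of a holomorphic function, the Schwarz-Pick inequality holds for its
  composition with holomorphic discs once all positive exponents are at least \<open>1\<close>: split off finite
  Blaschke products and use that the inequality is stable under products and under powers with
  exponent at least \<open>1\<close>. Hence \<open>artanh \<circ> \<phi>\<close> is a contraction from the Kobayashi distance. Finally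
  \<open>artanh \<phi> \<ge> - (1/2) ln (1 - \<phi>)\<close>, and in the cone \<open>1 - \<phi>(z)\<close> is bounded by a multiple of \<open>\<parallel>z - \<zeta>\<parallel>\<close>, which
  is comparable to the boundary distance.\<close>

section \<open>The Schwarz-Pick inequality for weighted products\<close>

text \<open>For \<open>s, t < 1\<close> this says \<open>artanh t \<le> artanh s + artanh r\<close>; the form without \<^const>\<open>artanh\<close>
  also covers moduli equal to \<open>1\<close>.\<close>

definition hyp_step :: "real \<Rightarrow> real \<Rightarrow> real \<Rightarrow> bool" where
  "hyp_step r s t \<longleftrightarrow> 0 \<le> s \<and> s \<le> 1 \<and> 0 \<le> t \<and> t \<le> 1 \<and> t * (1 + s * r) \<le> s + r"

text \<open>Multiply the bounds \<open>t1 \<le> (s1 + r) / (1 + s1 * r)\<close> and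
  \<open>t2 \<le> (s2 + r) / (1 + s2 * r)\<close>. The product of the right-hand sides is at most
  \<open>(s1 * s2 + r) / (1 + s1 * s2 * r)\<close>, because after clearing denominators the
  difference is the nonnegative
  \<open>r * (1 - r) * (1 - s1 * s2) * ((1 - s1) * (1 - s2))\<close>.\<close>

lemma hyp_step_mult:
  assumes r: "0 \<le> r" "r < 1" and 1: "hyp_step r s1 t1" and 2: "hyp_step r s2 t2"
  shows "hyp_step r (s1 * s2) (t1 * t2)"
proof -
  have b: "0 \<le> s1" "s1 \<le> 1" "0 \<le> t1" "t1 \<le> 1" "0 \<le> s2" "s2 \<le> 1" "0 \<le> t2" "t2 \<le> 1"
    and i: "t1 * (1 + s1 * r) \<le> s1 + r" "t2 * (1 + s2 * r) \<le> s2 + r"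
    using 1 2 by (auto simp: hyp_step_def)
  have p: "1 + s1 * r > 0" "1 + s2 * r > 0" "1 + s1 * s2 * r > 0"
    using b r by (simp_all add: add_pos_nonneg)
  have le1: "s1 * s2 \<le> 1" "t1 * t2 \<le> 1"
    using b by (simp_all add: mult_le_one)
  have "(t1 * (1 + s1 * r)) * (t2 * (1 + s2 * r)) \<le> (s1 + r) * (s2 + r)"
    using i b r p by (intro mult_mono) auto
  then have "(t1 * t2 * (1 + s1 * s2 * r)) * ((1 + s1 * r) * (1 + s2 * r))
      \<le> (s1 + r) * (s2 + r) * (1 + s1 * s2 * r)"
    using mult_right_mono[of "(t1 * (1 + s1 * r)) * (t2 * (1 + s2 * r))" "(s1 + r) * (s2 + r)" "1 + s1 * s2 * r"] p
    by (simp add: mult_ac)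
  also have "\<dots> = (s1 * s2 + r) * ((1 + s1 * r) * (1 + s2 * r))
      - r * (1 - r) * (1 - s1 * s2) * ((1 - s1) * (1 - s2))"
    by algebra
  also have "\<dots> \<le> (s1 * s2 + r) * ((1 + s1 * r) * (1 + s2 * r))"
    using b r le1 by simp
  finally have "t1 * t2 * (1 + s1 * s2 * r) \<le> s1 * s2 + r"
    using p by (simp add: mult_le_cancel_right)
  with b le1 show ?thesis by (simp add: hyp_step_def)
qed

lemma hyp_step_prod:
  assumes "0 \<le> r" "r < 1" "\<And>j. j \<in> J \<Longrightarrow> hyp_step r (s j) (t j)"
  shows "hyp_step r (\<Prod>j\<in>J. s j) (\<Prod>j\<in>J. t j)"
  using assms(3)
proof (induction J rule: infinite_finite_induct)
  case (insert x F)
  then show ?case using assms(1,2) by (simp add: hyp_step_mult)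
qed (use assms in \<open>simp_all add: hyp_step_def\<close>)

lemma sinh_mult_ge:
  fixes a u :: real
  assumes "1 \<le> a" "0 \<le> u"
  shows "a * sinh u \<le> sinh (a * u)"
proof -
  have "sinh (a * 0) - a * sinh 0 \<le> sinh (a * u) - a * sinh u"
  proof (rule DERIV_nonneg_imp_nondecreasing[OF assms(2)])
    fix x :: real assume x: "0 \<le> x" "x \<le> u"
    have "((\<lambda>u. sinh (a * u) - a * sinh u) has_real_derivative a * (cosh (a * x) - cosh x)) (at x)"
      by (auto intro!: derivative_eq_intros simp: algebra_simps)
    moreover have "cosh x \<le> cosh (a * x)"
      using x assms(1) mult_right_mono[of 1 a x] by (subst cosh_real_nonneg_le_iff) auto
    ultimately show "\<exists>y. ((\<lambda>u. sinh (a * u) - a * sinh u) has_real_derivative y) (at x) \<and> 0 \<le> y"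
      using assms(1) by force
  qed
  then show ?thesis by simp
qed

text \<open>The derivative of \<open>artanh (exp y)\<close> is \<open>1 / (2 * sinh (- y))\<close>,
  so the claim reduces to \<open>a * sinh u \<le> sinh (a * u)\<close>. With \<open>exp y\<close>
  and \<open>exp y'\<close> read as moduli, raising to the power \<open>a\<close> does not increase
  their hyperbolic gap.\<close>

lemma artanh_exp_mult_antimono:
  fixes a y y' :: real
  assumes a: "1 \<le> a" and y: "y \<le> y'" "y' < 0"
  shows "artanh (exp (a * y')) - artanh (exp y') \<le> artanh (exp (a * y)) - artanh (exp y)"
proof (rule DERIV_nonpos_imp_nonincreasing[OF y(1)])
  fix x assume x: "y \<le> x" "x \<le> y'"
  with y a have neg: "x < 0" "a * x < 0" by (auto simp: mult_less_0_iff)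
  have q: "exp u / (1 - exp u ^ 2) = 1 / (2 * sinh (- u))" if "u < 0" for u :: real
  proof -
    have "exp (u + u) < 1" using that by simp
    then have "1 - exp u ^ 2 \<noteq> 0" by (simp add: power2_eq_square flip: exp_add)
    then show ?thesis
      by (simp add: sinh_def exp_minus field_simps power2_eq_square)
  qed
  have "((\<lambda>y. artanh (exp (a * y)) - artanh (exp y)) has_real_derivative
      a * (exp (a * x) / (1 - exp (a * x) ^ 2)) - exp x / (1 - exp x ^ 2)) (at x)"
    using neg by (auto intro!: derivative_eq_intros DERIV_chain2[OF artanh_real_has_field_derivative])
  moreover have "a * (exp (a * x) / (1 - exp (a * x) ^ 2)) \<le> exp x / (1 - exp x ^ 2)"
  proof -
    have "a * sinh (- x) \<le> sinh (a * - x)" "sinh (- x) > 0" "sinh (a * - x) > 0"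
      using sinh_mult_ge[OF a, of "- x"] neg by auto
    then show ?thesis
      unfolding q[OF neg(1)] q[OF neg(2)] by (simp add: field_simps)
  qed
  ultimately show "\<exists>d. ((\<lambda>y. artanh (exp (a * y)) - artanh (exp y)) has_real_derivative d) (at x) \<and> d \<le> 0"
    by force
qed

lemma hyp_step_artanh:
  assumes r: "0 \<le> r" "r < 1" and st: "0 \<le> s" "s < 1" "0 \<le> t" "t < 1"
  shows "hyp_step r s t \<longleftrightarrow> artanh t \<le> artanh s + artanh r"
proof -
  have "artanh t \<le> artanh s + artanh r \<longleftrightarrow>
      ln ((1 + t) / (1 - t)) \<le> ln ((1 + s) / (1 - s) * ((1 + r) / (1 - r)))"
    using r st by (subst ln_mult) (auto simp: artanh_def)
  also have "\<dots> \<longleftrightarrow> (1 + t) / (1 - t) \<le> ((1 + s) * (1 + r)) / ((1 - s) * (1 - r))"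
    using r st by (subst ln_le_cancel_iff) (auto intro!: mult_pos_pos divide_pos_pos)
  also have "\<dots> \<longleftrightarrow> (1 + t) * ((1 - s) * (1 - r)) \<le> ((1 + s) * (1 + r)) * (1 - t)"
    using r st by (simp add: pos_divide_le_eq pos_le_divide_eq)
  also have "\<dots> \<longleftrightarrow> t * (1 + s * r) \<le> s + r"
    by (auto simp: algebra_simps)
  finally show ?thesis using st by (simp add: hyp_step_def)
qed

text \<open>The hypothesis \<open>1 \<le> a\<close> is essential: \<open>cmod z powr a\<close> with \<open>a < 1\<close> violates the Schwarz-Pick
  inequality at \<open>0\<close>. Hence the normalisation of positive exponents below.\<close>

lemma hyp_step_powr:
  assumes r: "0 \<le> r" "r < 1" and a: "1 \<le> a" and "hyp_step r s t"
  shows "hyp_step r (s powr a) (t powr a)"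
proof -
  have b: "0 \<le> s" "s \<le> 1" "0 \<le> t" "t \<le> 1" and i: "t * (1 + s * r) \<le> s + r"
    using assms by (auto simp: hyp_step_def)
  have le1: "s powr a \<le> 1" "t powr a \<le> 1"
    using b a by (auto intro: powr_le1)
  \<comment> \<open>Only the last case needs the hyperbolic comparison. The others are the trivial
    one, where the modulus does not grow, and the values at which \<open>artanh\<close> or
    \<open>ln\<close> is singular.\<close>
  consider "t \<le> s" | "t = 1" "s < t" | "s = 0" "s < t" | "0 < s" "s < t" "t < 1" using b by linarith
  then show ?thesis
  proof cases
    case 1
    then have "t powr a \<le> s powr a" using b a by (intro powr_mono2) auto
    moreover have "(t powr a * s powr a) * r \<le> r"
      using le1 r by (intro mult_left_le_one_le mult_le_one) auto
    ultimately show ?thesis using le1 by (simp add: hyp_step_def algebra_simps)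
  next
    case 2
    then have "(1 - s) * (1 - r) \<le> 0" using i by (simp add: algebra_simps)
    with 2 r show ?thesis by (simp add: mult_le_0_iff)
  next
    case 3
    have "t powr a \<le> t powr 1" using b a 3 by (intro powr_mono') auto
    then show ?thesis using 3 le1 i by (simp add: hyp_step_def)
  next
    case 4
    have e: "exp (a * ln s) = s powr a" "exp (a * ln t) = t powr a" "exp (ln s) = s" "exp (ln t) = t"
      using 4 by (auto simp: powr_def)
    have lt: "s powr a < 1" "t powr a < 1" using 4 a powr_less_mono2[of a s 1] powr_less_mono2[of a t 1] by auto
    have "artanh (t powr a) - artanh t \<le> artanh (s powr a) - artanh s"
      using artanh_exp_mult_antimono[OF a, of "ln s" "ln t"] 4 unfolding e by auto
    moreover have "artanh t \<le> artanh s + artanh r"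
      using assms 4 by (subst hyp_step_artanh[symmetric]) auto
    ultimately show ?thesis
      using lt r by (subst hyp_step_artanh) auto
  qed
qed

section \<open>Schwarz-Pick for holomorphic functions\<close>

text \<open>With \<open>A = cmod (1 - cnj w * y)\<close> and \<open>N = 1 - cmod w * cmod y\<close>,
  the differences \<open>A^2 - cmod (y - w)^2\<close> and \<open>N^2 - (cmod y - cmod w)^2\<close>
  both equal \<open>(1 - cmod w ^ 2) * (1 - cmod y ^ 2)\<close>. Hence \<open>N \<le> A\<close>
  compares the two quotients.\<close>

lemma norm_Moebius_ge:
  assumes w: "cmod w < 1" and y: "cmod y < 1"
  shows "cmod y - cmod w \<le> cmod ((y - w) / (1 - cnj w * y)) * (1 - cmod w * cmod y)"
proof -
  define A where "A = cmod (1 - cnj w * y)"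
  have A: "1 - cmod w * cmod y \<le> A"
    unfolding A_def using norm_triangle_ineq2[of 1 "cnj w * y"] by (simp add: norm_mult)
  have wy: "cmod w * cmod y < 1"
    using w y mult_le_one[of "cmod w" "cmod y"] mult_strict_mono[of "cmod w" 1 "cmod y" 1] by auto
  then have A0: "A > 0" using A by linarith
  show ?thesis
  proof (cases "cmod y \<le> cmod w")
    case True
    then show ?thesis using wy by (smt (verit) mult_nonneg_nonneg norm_ge_zero)
  next
    case False
    have id: "A\<^sup>2 - (cmod (y - w))\<^sup>2 = (1 - (cmod w)\<^sup>2) * (1 - (cmod y)\<^sup>2)"
      unfolding A_def cmod_power2 by (simp add: algebra_simps power2_eq_square)
    have "(A * (cmod y - cmod w))\<^sup>2 \<le> (cmod (y - w) * (1 - cmod w * cmod y))\<^sup>2"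
    proof -
      have id2: "(1 - cmod w * cmod y)\<^sup>2 - (cmod y - cmod w)\<^sup>2 = (1 - (cmod w)\<^sup>2) * (1 - (cmod y)\<^sup>2)"
        by (simp add: algebra_simps power2_eq_square)
      have P: "0 \<le> (1 - (cmod w)\<^sup>2) * (1 - (cmod y)\<^sup>2)"
        using w y by (simp add: abs_square_le_1)
      have sq: "(1 - cmod w * cmod y)\<^sup>2 \<le> A\<^sup>2" using A wy by (intro power_mono) auto
      define N P where "N = 1 - cmod w * cmod y" and "P = (1 - (cmod w)\<^sup>2) * (1 - (cmod y)\<^sup>2)"
      have X: "(cmod (y - w))\<^sup>2 = A\<^sup>2 - P" and Y: "(cmod y - cmod w)\<^sup>2 = N\<^sup>2 - P"
        using id id2 by (simp_all add: N_def P_def)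
      have "(cmod (y - w) * N)\<^sup>2 - (A * (cmod y - cmod w))\<^sup>2 = P * (A\<^sup>2 - N\<^sup>2)"
        unfolding power_mult_distrib X Y by (simp add: algebra_simps)
      also have "\<dots> \<ge> 0" using P sq by (simp add: P_def N_def)
      finally show ?thesis by (simp add: N_def)
    qed
    then have "A * (cmod y - cmod w) \<le> cmod (y - w) * (1 - cmod w * cmod y)"
      using wy by (auto elim!: power2_le_imp_le)
    then show ?thesis
      using A0 unfolding norm_divide A_def[symmetric]
      by (simp only: times_divide_eq_left pos_le_divide_eq) (simp only: mult.commute)
  qed
qed

definition pseudo_hyp :: "complex \<Rightarrow> complex \<Rightarrow> real" where
  "pseudo_hyp l m = cmod ((l - m) / (1 - cnj m * l))"

lemma pseudo_hyp_bounds: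
  assumes "l \<in> ball 0 1" "m \<in> ball 0 1"
  shows "0 \<le> pseudo_hyp l m" "pseudo_hyp l m < 1"
  using Moebius_function_norm_lt_1[of m l 0] assms
  by (auto simp: pseudo_hyp_def Moebius_function_simple)

lemma pseudo_hyp_commute: "pseudo_hyp l m = pseudo_hyp m l"
proof -
  have "cmod (1 - cnj m * l) = cmod (cnj (1 - cnj m * l))" by (rule complex_mod_cnj[symmetric])
  also have "\<dots> = cmod (1 - cnj l * m)" by (simp add: mult.commute)
  finally show ?thesis by (simp add: pseudo_hyp_def norm_divide norm_minus_commute)
qed

text \<open>Multiplication by \<open>c < 1\<close> moves the values into the open disc. Moebius maps
  then carry \<open>l\<close> and its image to 0, where the Schwarz lemma applies. Letting
  \<open>c\<close> tend to 1 covers values in the closed disc, including unimodular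
  constants.\<close>

lemma hyp_step_holomorphic:
  assumes hol: "f holomorphic_on ball 0 1" and le: "\<And>z. z \<in> ball 0 1 \<Longrightarrow> cmod (f z) \<le> 1"
    and l: "l \<in> ball 0 1" and m: "m \<in> ball 0 1"
  shows "hyp_step (pseudo_hyp l m) (cmod (f l)) (cmod (f m))"
proof -
  define r where "r = pseudo_hyp l m"
  have *: "c * cmod (f m) * (1 + c * cmod (f l) * r) \<le> c * cmod (f l) + r" if c: "0 < c" "c < 1" for c
  proof -
    define F where "F z = of_real c * f z" for z
    have Fn: "cmod (F z) = c * cmod (f z)" for z using c by (simp add: F_def norm_mult)
    have F1: "cmod (F z) < 1" if "z \<in> ball 0 1" for z
      using le[OF that] c mult_left_mono[OF le[OF that], of c] unfolding Fn by linarith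
    define H where "H = Moebius_function 0 (F l) \<circ> (F \<circ> Moebius_function 0 (- l))"
    have M1: "Moebius_function 0 (- l) ` ball 0 1 \<subseteq> ball 0 1"
      using l Moebius_function_norm_lt_1[of "- l"] by auto
    have "H holomorphic_on ball 0 1"
      unfolding H_def
    proof (rule holomorphic_on_compose_gen[where t = "ball 0 1"])
      show "F \<circ> Moebius_function 0 (- l) holomorphic_on ball 0 1"
      proof (rule holomorphic_on_compose_gen[OF _ _ M1])
        show "F holomorphic_on ball 0 1" unfolding F_def by (intro holomorphic_intros hol)
        show "Moebius_function 0 (- l) holomorphic_on ball 0 1"
          using l by (intro Moebius_function_holomorphic) auto
      qed
      show "Moebius_function 0 (F l) holomorphic_on ball 0 1"
        using F1[OF l] by (rule Moebius_function_holomorphic)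
      show "(F \<circ> Moebius_function 0 (- l)) ` ball 0 1 \<subseteq> ball 0 1"
        using M1 F1 by (auto simp: image_subset_iff)
    qed
    moreover have "H 0 = 0"
      by (simp add: H_def Moebius_function_of_zero Moebius_function_eq_zero)
    moreover have "cmod (H z) < 1" if "cmod z < 1" for z
      unfolding H_def o_def using that M1 F1 l by (intro Moebius_function_norm_lt_1) (auto simp: image_subset_iff)
    moreover define z where "z = Moebius_function 0 l m"
    have z: "cmod z < 1" unfolding z_def using l m by (intro Moebius_function_norm_lt_1) auto
    ultimately have "cmod (H z) \<le> cmod z"
      using Schwarz_Lemma(1) by blast
    moreover have "Moebius_function 0 (- l) z = m"
      unfolding z_def using l m by (intro Moebius_function_compose) auto
    moreover have "cmod z = r"
      unfolding r_def pseudo_hyp_commute[of l] by (simp add: z_def pseudo_hyp_def Moebius_function_simple)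
    ultimately have H: "cmod (Moebius_function 0 (F l) (F m)) \<le> r" by (simp add: H_def)
    have "cmod (F l) * cmod (F m) \<le> 1"
      using F1[OF l] F1[OF m] by (simp add: mult_le_one less_imp_le)
    then have "cmod (F m) - cmod (F l) \<le> r * (1 - cmod (F l) * cmod (F m))"
      using norm_Moebius_ge[OF F1[OF l] F1[OF m]] mult_right_mono[OF H, of "1 - cmod (F l) * cmod (F m)"]
      by (simp add: Moebius_function_simple)
    then show ?thesis unfolding Fn by (simp add: algebra_simps)
  qed
  have "cmod (f m) * (1 + cmod (f l) * r) \<le> cmod (f l) + r"
  proof (rule tendsto_le[of "at_left (1::real)"])
    show "((\<lambda>c. c * cmod (f m) * (1 + c * cmod (f l) * r)) \<longlongrightarrow> cmod (f m) * (1 + cmod (f l) * r)) (at_left 1)"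
      by (auto intro!: tendsto_eq_intros)
    show "((\<lambda>c. c * cmod (f l) + r) \<longlongrightarrow> cmod (f l) + r) (at_left 1)"
      by (auto intro!: tendsto_eq_intros)
    show "\<forall>\<^sub>F c in at_left 1. c * cmod (f m) * (1 + c * cmod (f l) * r) \<le> c * cmod (f l) + r"
      using eventually_at_left_real[OF zero_less_one] by eventually_elim (use * in auto)
  qed simp
  then show ?thesis using le l m by (simp add: hyp_step_def r_def)
qed

section \<open>Finite Blaschke products and the maximum principle\<close>

text \<open>Approach to the unit circle from inside, uniformly in the argument: an eventual property
  holds on an annulus \<open>s < cmod z < 1\<close>, hence on entire circles.\<close>

abbreviation boundary_filter :: "complex filter" where
  "boundary_filter \<equiv> filtercomap cmod (at_left 1)"

lemma tendsto_cmod_Moebius: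
  assumes "cmod w < 1"
  shows "((\<lambda>z. cmod (Moebius_function 0 w z)) \<longlongrightarrow> 1) boundary_filter"
proof (rule tendsto_sandwich)
  have ev: "\<forall>\<^sub>F z in boundary_filter. cmod z < 1"
    by (rule eventually_filtercomapI) (auto simp: eventually_at_filter)
  show "\<forall>\<^sub>F z in boundary_filter. cmod (Moebius_function 0 w z) \<le> 1"
    using ev by eventually_elim (use Moebius_function_norm_lt_1[OF assms] in \<open>auto intro: less_imp_le\<close>)
  show "\<forall>\<^sub>F z in boundary_filter. (cmod z - cmod w) / (1 - cmod w * cmod z) \<le> cmod (Moebius_function 0 w z)"
    using ev
  proof eventually_elim
    fix z assume z: "cmod z < 1"
    have "cmod w * cmod z < 1"
      using norm_mult_less[OF assms z] by (simp add: norm_mult)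
    with norm_Moebius_ge[OF assms z] show "(cmod z - cmod w) / (1 - cmod w * cmod z) \<le> cmod (Moebius_function 0 w z)"
      by (simp add: Moebius_function_simple field_simps)
  qed
  have "((\<lambda>x. (x - cmod w) / (1 - cmod w * x)) \<longlongrightarrow> 1) (at_left 1)"
    using assms by (auto intro!: tendsto_eq_intros)
  then show "((\<lambda>z. (cmod z - cmod w) / (1 - cmod w * cmod z)) \<longlongrightarrow> 1) boundary_filter"
    by (rule filterlim_compose[OF _ filterlim_filtercomap])
qed simp

text \<open>\<open>B\<close> stands for a finite Blaschke product collecting the zeros of
  \<open>F\<close>, and \<open>h\<close> for the zero-free rest. The last clause makes
  \<open>B\<close> trivial for zero-free \<open>F\<close>, because these may carry exponents below
  1, which the power rule for \<open>hyp_step\<close> excludes.\<close>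

definition Blaschke_factorization :: "(complex \<Rightarrow> complex) \<Rightarrow> (complex \<Rightarrow> complex) \<Rightarrow> (complex \<Rightarrow> complex) \<Rightarrow> bool" where
  "Blaschke_factorization F B h \<longleftrightarrow> B holomorphic_on ball 0 1 \<and> h holomorphic_on ball 0 1 \<and>
    (\<forall>z\<in>ball 0 1. F z = B z * h z \<and> h z \<noteq> 0 \<and> cmod (B z) \<le> 1) \<and>
    ((\<lambda>z. cmod (B z)) \<longlongrightarrow> 1) boundary_filter \<and>
    ((\<forall>z\<in>ball 0 1. F z \<noteq> 0) \<longrightarrow> B = (\<lambda>_. 1))"

text \<open>Induction on the zero set. Replacing the factor \<open>(z - \<alpha>) ^ n\<close> by the
  zero-free \<open>(1 - cnj \<alpha> * z) ^ n\<close> removes the zero \<open>\<alpha>\<close>; the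
  quotient of the two is the \<open>n\<close>-th power of a Moebius function and joins
  \<open>B\<close>.\<close>

lemma finite_Blaschke_factorization_exists:
  assumes "finite Z" "F holomorphic_on ball 0 1" "{z \<in> ball 0 1. F z = 0} = Z"
  shows "\<exists>B h. Blaschke_factorization F B h"
  using assms
proof (induction Z arbitrary: F rule: finite_induct)
  case empty
  then show ?case
    by (intro exI[of _ "\<lambda>_. 1"] exI[of _ F]) (auto simp: Blaschke_factorization_def)
next
  case (insert \<alpha> Z)
  have \<alpha>: "\<alpha> \<in> ball 0 1" "F \<alpha> = 0" using insert.prems by auto
  have "\<not> F constant_on ball 0 1"
  proof
    assume "F constant_on ball 0 1"
    then have "{z \<in> ball 0 1. F z = 0} = ball 0 1"
      using \<alpha> by (force simp: constant_on_def)
    then have "finite (ball (0::complex) 1)"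
      using insert.prems insert.hyps by simp
    then show False
      using uncountable_ball[of 1 "0::complex"] by (simp add: uncountable_infinite)
  qed
  then obtain g r n where gr: "0 < n" "0 < r" "ball \<alpha> r \<subseteq> ball 0 1" "g holomorphic_on ball \<alpha> r"
      "\<And>w. w \<in> ball \<alpha> r \<Longrightarrow> F w = (w - \<alpha>) ^ n * g w" "\<And>w. w \<in> ball \<alpha> r \<Longrightarrow> g w \<noteq> 0"
    using holomorphic_factor_zero_nonconstant[OF insert.prems(1) open_ball connected_ball \<alpha>] by metis
  \<comment> \<open>The local factor \<open>g\<close> and the quotient agree where both make sense,
    so the glued function is holomorphic on the whole disc and nonzero at
    \<open>\<alpha>\<close>.\<close>
  define h where "h z = (if z \<in> ball \<alpha> r then g z else F z / (z - \<alpha>) ^ n)" for z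
  have heq: "h z = F z / (z - \<alpha>) ^ n" if "z \<noteq> \<alpha>" for z
    using gr(5) that by (auto simp: h_def)
  have "h holomorphic_on ball \<alpha> r"
    using gr(4) by (rule holomorphic_transform) (simp add: h_def)
  moreover have "h holomorphic_on ball 0 1 - {\<alpha>}"
  proof (rule holomorphic_transform)
    show "(\<lambda>z. F z / (z - \<alpha>) ^ n) holomorphic_on ball 0 1 - {\<alpha>}"
      using insert.prems(1) by (auto intro!: holomorphic_intros intro: holomorphic_on_subset)
  qed (auto simp: heq)
  ultimately have "h holomorphic_on ball \<alpha> r \<union> (ball 0 1 - {\<alpha>})"
    by (intro holomorphic_on_Un) auto
  moreover have "ball \<alpha> r \<union> (ball 0 1 - {\<alpha>}) = ball 0 1"
    using gr \<alpha> by auto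
  ultimately have hh: "h holomorphic_on ball 0 1" by simp
  have Fh: "F z = (z - \<alpha>) ^ n * h z" if "z \<in> ball 0 1" for z
    using gr(1,2) \<alpha>(2) by (cases "z = \<alpha>") (auto simp: heq)
  have nz: "1 - cnj \<alpha> * z \<noteq> 0" if "z \<in> ball 0 1" for z
  proof -
    have "cmod (cnj \<alpha> * z) < 1"
      using norm_mult_less[of "cnj \<alpha>" 1 z 1] that \<alpha> by simp
    then show ?thesis by auto
  qed
  have "h \<alpha> \<noteq> 0" using gr by (simp add: h_def)
  define F1 where "F1 z = (1 - cnj \<alpha> * z) ^ n * h z" for z
  have "F1 holomorphic_on ball 0 1"
    unfolding F1_def by (intro holomorphic_intros hh)
  moreover have "{z \<in> ball 0 1. F1 z = 0} = Z"
  proof -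
    have "F1 z = 0 \<longleftrightarrow> z \<in> Z" if z: "z \<in> ball 0 1" for z
    proof (cases "z = \<alpha>")
      case True
      then show ?thesis using \<open>h \<alpha> \<noteq> 0\<close> nz[OF z] insert.hyps by (simp add: F1_def)
    next
      case False
      then have "F1 z = 0 \<longleftrightarrow> F z = 0" using nz[OF z] Fh[OF z] by (simp add: F1_def)
      then show ?thesis using insert.prems(2) False z by blast
    qed
    then show ?thesis using insert.prems(2) by blast
  qed
  ultimately have F1: "F1 holomorphic_on ball 0 1" "{z \<in> ball 0 1. F1 z = 0} = Z"
    by simp_all
  obtain B h1 where IH: "B holomorphic_on ball 0 1" "h1 holomorphic_on ball 0 1"
      "\<And>z. z \<in> ball 0 1 \<Longrightarrow> F1 z = B z * h1 z \<and> h1 z \<noteq> 0 \<and> cmod (B z) \<le> 1"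
      "((\<lambda>z. cmod (B z)) \<longlongrightarrow> 1) boundary_filter"
    using insert.IH[OF F1] unfolding Blaschke_factorization_def by meson
  define B1 where "B1 z = Moebius_function 0 \<alpha> z ^ n * B z" for z
  have "B1 holomorphic_on ball 0 1"
    unfolding B1_def using \<alpha>(1) by (intro holomorphic_intros IH Moebius_function_holomorphic) auto
  moreover have "F z = B1 z * h1 z" if z: "z \<in> ball 0 1" for z
  proof -
    have "F z = (z - \<alpha>) ^ n / (1 - cnj \<alpha> * z) ^ n * F1 z"
      using Fh[OF z] nz[OF z] by (simp add: F1_def)
    then show ?thesis
      using IH(3)[OF z] by (simp add: B1_def Moebius_function_simple power_divide)
  qed
  moreover have "cmod (B1 z) \<le> 1" if z: "z \<in> ball 0 1" for z
    using IH(3)[OF z] Moebius_function_norm_lt_1[of \<alpha> z 0] z \<alpha>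
    by (auto simp: B1_def norm_mult norm_power intro!: mult_le_one power_le_one)
  moreover have "((\<lambda>z. cmod (B1 z)) \<longlongrightarrow> 1) boundary_filter"
    unfolding B1_def norm_mult norm_power
    using tendsto_mult[OF tendsto_power[OF tendsto_cmod_Moebius, of \<alpha> n] IH(4)] \<alpha> by simp
  ultimately show ?case
    using IH(2,3) \<alpha> by (intro exI[of _ B1] exI[of _ h1]) (auto simp: Blaschke_factorization_def)
qed

text \<open>If \<open>cmod (G z)\<close> exceeded 1, some \<open>c < 1\<close> with
  \<open>1 / c < cmod (G z)\<close> would lie below \<open>k\<close> on circles close to the unit
  circle. On such a circle around \<open>z\<close> the hypothesis gives
  \<open>cmod (G w) \<le> 1 / c\<close>, against the maximum principle. In the application
  \<open>k\<close> is the Blaschke part, which may vanish inside the disc.\<close>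

lemma maximum_modulus_boundary_weight:
  assumes hol: "G holomorphic_on ball 0 1" and k: "(k \<longlongrightarrow> (1::real)) boundary_filter"
    and le: "\<And>z. z \<in> ball 0 1 \<Longrightarrow> cmod (G z) * k z \<le> 1" and z: "z \<in> ball 0 1"
  shows "cmod (G z) \<le> 1"
proof (rule ccontr)
  assume "\<not> cmod (G z) \<le> 1"
  then have g: "1 < cmod (G z)" by simp
  define q where "q = 1 / cmod (G z)"
  have q: "0 < q" "q < 1" using g unfolding q_def by (auto simp: divide_less_eq)
  then obtain c where c: "q < c" "c < 1" using dense by blast
  have c0: "0 < c" using q c by simp
  have c1: "1 / c < cmod (G z)"
  proof -
    have "1 < c * cmod (G z)"
      using c(1) g unfolding q_def by (subst (asm) pos_divide_less_eq) auto
    then show ?thesis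
      using c0 by (simp add: pos_divide_less_eq mult.commute)
  qed
  have "\<forall>\<^sub>F w in boundary_filter. c < k w"
    using k c by (simp add: order_tendstoD)
  then obtain P where P: "\<forall>\<^sub>F x in at_left 1. P x" "\<And>w. P (cmod w) \<Longrightarrow> c < k w"
    by (auto simp: eventually_filtercomap)
  obtain s0 where s0: "s0 < 1" "\<And>x. s0 < x \<Longrightarrow> x < 1 \<Longrightarrow> P x"
    using P(1) eventually_at_left[of "0::real" 1 P] by auto
  obtain s where s: "max s0 (cmod z) < s" "s < 1"
    using s0 z dense[of "max s0 (cmod z)" 1] by auto
  then have spos: "0 < s" using norm_ge_zero[of z] by linarith
  have sub: "cball 0 s \<subseteq> ball (0::complex) 1" using s by auto
  have "cmod (G z) \<le> 1 / c"
  proof (rule maximum_modulus_frontier[of G "cball 0 s"])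
    show "G holomorphic_on interior (cball 0 s)"
      using hol by (rule holomorphic_on_subset) (use s in auto)
    show "continuous_on (closure (cball 0 s)) G"
      using holomorphic_on_subset[OF hol sub] by (auto intro: holomorphic_on_imp_continuous_on)
    show "z \<in> cball 0 s" using s by simp
    fix w assume "w \<in> frontier (cball (0::complex) s)"
    then have w: "cmod w = s" using spos by simp
    then have "c < k w" using s s0 P(2) by auto
    have "w \<in> ball 0 1" using w s by simp
    from le[OF this] have "cmod (G w) * c \<le> 1"
      using mult_left_mono[of c "k w" "cmod (G w)"] \<open>c < k w\<close> by simp
    then show "cmod (G w) \<le> 1 / c" using c0 by (simp add: field_simps)
  qed auto
  with c1 show False by simp
qed

section \<open>Schwarz-Pick for weighted products\<close>

text \<open>Without its Blaschke factor each \<open>F j\<close> is an exponential, so its real power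
  is the modulus of a holomorphic function. The product becomes \<open>cmod (G z) * k z\<close> with
  \<open>G\<close> holomorphic and the Blaschke part \<open>k\<close> tending to 1 at the circle.
  The maximum principle bounds \<open>G\<close>, and both factors satisfy
  \<open>hyp_step\<close>.\<close>

lemma hyp_step_weighted_prod_finite_zeros:
  fixes F :: "'j \<Rightarrow> complex \<Rightarrow> complex"
  assumes J: "finite J" and hol: "\<And>j. j \<in> J \<Longrightarrow> F j holomorphic_on ball 0 1"
    and fin: "\<And>j. j \<in> J \<Longrightarrow> finite {z \<in> ball 0 1. F j z = 0}"
    and a: "\<And>j. j \<in> J \<Longrightarrow> 1 \<le> a j \<or> (\<forall>z\<in>ball 0 1. F j z \<noteq> 0)"
    and le: "\<And>z. z \<in> ball 0 1 \<Longrightarrow> (\<Prod>j\<in>J. cmod (F j z) powr a j) \<le> 1"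
    and l: "l \<in> ball 0 1" and m: "m \<in> ball 0 1"
  shows "hyp_step (pseudo_hyp l m) (\<Prod>j\<in>J. cmod (F j l) powr a j) (\<Prod>j\<in>J. cmod (F j m) powr a j)"
proof -
  have "\<forall>j\<in>J. \<exists>B h. Blaschke_factorization (F j) B h"
    by (intro ballI finite_Blaschke_factorization_exists[OF fin hol refl])
  then obtain B h where fac: "\<And>j. j \<in> J \<Longrightarrow> Blaschke_factorization (F j) (B j) (h j)"
    by metis
  have Bh: "B j holomorphic_on ball 0 1" "h j holomorphic_on ball 0 1"
      "((\<lambda>z. cmod (B j z)) \<longlongrightarrow> 1) boundary_filter"
      "\<forall>z\<in>ball 0 1. F j z \<noteq> 0 \<Longrightarrow> B j = (\<lambda>_. 1)" if "j \<in> J" for j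
    using fac[OF that] by (simp_all add: Blaschke_factorization_def)
  have Bhz: "F j z = B j z * h j z" "h j z \<noteq> 0" "cmod (B j z) \<le> 1" if "j \<in> J" "z \<in> ball 0 1" for j z
    using fac[OF that(1)] that(2) unfolding Blaschke_factorization_def by blast+
  have "\<forall>j\<in>J. \<exists>g. g holomorphic_on ball 0 1 \<and> (\<forall>z\<in>ball 0 1. h j z = exp (g z))"
  proof
    fix j assume j: "j \<in> J"
    obtain g where "g holomorphic_on ball 0 1" "\<And>z. z \<in> ball 0 1 \<Longrightarrow> exp (g z) = h j z"
      using holomorphic_logarithm_exists[OF convex_ball open_ball Bh(2)[OF j] Bhz(2)[OF j], of 0] by auto
    then show "\<exists>g. g holomorphic_on ball 0 1 \<and> (\<forall>z\<in>ball 0 1. h j z = exp (g z))"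
      by (intro exI[of _ g]) simp
  qed
  then obtain g where g: "\<And>j. j \<in> J \<Longrightarrow> g j holomorphic_on ball 0 1"
    "\<And>j z. j \<in> J \<Longrightarrow> z \<in> ball 0 1 \<Longrightarrow> h j z = exp (g j z)"
    by metis
  define G where "G z = exp (\<Sum>j\<in>J. of_real (a j) * g j z)" for z
  have Ghol: "G holomorphic_on ball 0 1"
    unfolding G_def by (intro holomorphic_intros g)
  define k where "k z = (\<Prod>j\<in>J. cmod (B j z) powr a j)" for z
  have k: "(k \<longlongrightarrow> 1) boundary_filter"
  proof -
    have "((\<lambda>z. \<Prod>j\<in>J. cmod (B j z) powr a j) \<longlongrightarrow> (\<Prod>j\<in>J. 1 powr a j)) boundary_filter"
      by (intro tendsto_prod tendsto_powr Bh(3) tendsto_const) auto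
    then show ?thesis unfolding k_def[abs_def] by simp
  qed
  have eq: "(\<Prod>j\<in>J. cmod (F j z) powr a j) = cmod (G z) * k z" if z: "z \<in> ball 0 1" for z
  proof -
    have "cmod (F j z) powr a j = cmod (exp (of_real (a j) * g j z)) * cmod (B j z) powr a j" if "j \<in> J" for j
    proof -
      have "cmod (exp (g j z)) powr a j = cmod (exp (of_real (a j) * g j z))"
        by (simp add: norm_exp_eq_Re powr_def)
      then show ?thesis
        unfolding Bhz(1)[OF that z] g(2)[OF that z] norm_mult by (subst powr_mult) auto
    qed
    then have "(\<Prod>j\<in>J. cmod (F j z) powr a j) = (\<Prod>j\<in>J. cmod (exp (of_real (a j) * g j z))) * k z"
      by (simp add: k_def prod.distrib cong: prod.cong)
    then show ?thesis by (simp only: G_def exp_sum[OF J] prod_norm)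
  qed
  have r: "0 \<le> pseudo_hyp l m" "pseudo_hyp l m < 1" using pseudo_hyp_bounds[OF l m] by auto
  have G1: "cmod (G z) \<le> 1" if "z \<in> ball 0 1" for z
    using Ghol k _ that
  proof (rule maximum_modulus_boundary_weight)
    show "cmod (G w) * k w \<le> 1" if "w \<in> ball 0 1" for w
      using le[OF that] by (simp only: eq[OF that])
  qed
  have "hyp_step (pseudo_hyp l m) (cmod (B j l) powr a j) (cmod (B j m) powr a j)" if j: "j \<in> J" for j
  proof (cases "1 \<le> a j")
    case True
    then show ?thesis
      by (intro hyp_step_powr[OF r] hyp_step_holomorphic[OF Bh(1)[OF j] Bhz(3)[OF j] l m])
  next
    case False
    then have "B j = (\<lambda>_. 1)" using a[OF j] by (intro Bh(4)[OF j]) auto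
    then show ?thesis using r by (simp add: hyp_step_def)
  qed
  then have "hyp_step (pseudo_hyp l m) (k l) (k m)"
    unfolding k_def using r by (intro hyp_step_prod) auto
  then show ?thesis
    unfolding eq[OF l] eq[OF m] by (intro hyp_step_mult[OF r] hyp_step_holomorphic[OF Ghol G1 l m])
qed

text \<open>The dilation \<open>F j (R * z)\<close> with \<open>R < 1\<close> has finitely many
  zeros, by compactness, and takes the original values at \<open>l / R\<close> and
  \<open>m / R\<close>. The claim follows as \<open>R\<close> tends to 1.\<close>

lemma hyp_step_weighted_prod:
  fixes F :: "'j \<Rightarrow> complex \<Rightarrow> complex"
  assumes J: "finite J" and hol: "\<And>j. j \<in> J \<Longrightarrow> F j holomorphic_on ball 0 1"
    and a: "\<And>j. j \<in> J \<Longrightarrow> 1 \<le> a j \<or> (\<forall>z\<in>ball 0 1. F j z \<noteq> 0)"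
    and le: "\<And>z. z \<in> ball 0 1 \<Longrightarrow> (\<Prod>j\<in>J. cmod (F j z) powr a j) \<le> 1"
    and l: "l \<in> ball 0 1" and m: "m \<in> ball 0 1"
  shows "hyp_step (pseudo_hyp l m) (\<Prod>j\<in>J. cmod (F j l) powr a j) (\<Prod>j\<in>J. cmod (F j m) powr a j)"
\<comment> \<open>An identically vanishing factor keeps infinitely many zeros under dilation. Both
  products are then 0, since \<open>0 powr a = 0\<close>.\<close>
proof (cases "\<exists>j\<in>J. \<forall>z\<in>ball 0 1. F j z = 0")
  case True
  then obtain j where j: "j \<in> J" "\<And>z. z \<in> ball 0 1 \<Longrightarrow> F j z = 0" by blast
  have "(\<Prod>j\<in>J. cmod (F j z) powr a j) = 0" if "z \<in> ball 0 1" for z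
    using j(1) j(2)[OF that] J by (intro prod_zero) force+
  then show ?thesis using l m pseudo_hyp_bounds[OF l m] by (simp add: hyp_step_def)
next
  case False
  define s t where "s = (\<Prod>j\<in>J. cmod (F j l) powr a j)" and "t = (\<Prod>j\<in>J. cmod (F j m) powr a j)"
  have *: "hyp_step (pseudo_hyp (l / of_real R) (m / of_real R)) s t"
    if R: "max (cmod l) (cmod m) < R" "R < 1" for R
  proof -
    have R0: "R > 0" using R norm_ge_zero[of l] by linarith
    have sub: "of_real R * z \<in> ball 0 1" if "z \<in> ball 0 1" for z :: complex
      using that R R0 mult_strict_mono[of R 1 "cmod z" 1] by (simp add: norm_mult)
    have "hyp_step (pseudo_hyp (l / of_real R) (m / of_real R))
        (\<Prod>j\<in>J. cmod (F j (of_real R * (l / of_real R))) powr a j)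
        (\<Prod>j\<in>J. cmod (F j (of_real R * (m / of_real R))) powr a j)"
    proof (rule hyp_step_weighted_prod_finite_zeros[OF J])
      fix j assume j: "j \<in> J"
      have "F j \<circ> (\<lambda>z. of_real R * z) holomorphic_on ball 0 1"
        using sub by (intro holomorphic_on_compose_gen[OF _ hol[OF j]] holomorphic_intros) auto
      then show "(\<lambda>z. F j (of_real R * z)) holomorphic_on ball 0 1" by (simp add: o_def)
      have "finite {z \<in> cball 0 R. F j z = 0}"
      proof (cases "F j constant_on ball 0 1")
        case True
        then have "{z \<in> cball 0 R. F j z = 0} = {}"
          using False j R by (force simp: constant_on_def)
        then show ?thesis by (metis finite.emptyI)
      next
        case False
        then show ?thesis
          using R by (intro holomorphic_compact_finite_zeros[OF hol[OF j]]) auto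
      qed
      then have "finite ((\<lambda>z. of_real R * z) -` {z \<in> cball 0 R. F j z = 0})"
        using R0 by (intro finite_vimageI) (auto simp: inj_def)
      then show "finite {z \<in> ball 0 1. F j (of_real R * z) = 0}"
        by (rule finite_subset[rotated]) (use R0 in \<open>auto simp: norm_mult\<close>)
      show "1 \<le> a j \<or> (\<forall>z\<in>ball 0 1. F j (of_real R * z) \<noteq> 0)"
        using a[OF j] sub by blast
    next
      show "l / of_real R \<in> ball 0 1" "m / of_real R \<in> ball 0 1"
        using R R0 by (auto simp: norm_divide)
    qed (use le sub in blast)
    then show ?thesis using R0 by (simp add: s_def t_def)
  qed
  have ev: "\<forall>\<^sub>F R in at_left 1. R \<in> {max (cmod l) (cmod m)<..<1}"
    using l m by (intro eventually_at_left_real) auto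
  have "1 - cnj m * l \<noteq> 0"
  proof -
    have "cmod (cnj m * l) < 1"
      using norm_mult_less[of "cnj m" 1 l 1] l m by simp
    then show ?thesis by auto
  qed
  then have lim: "((\<lambda>R. pseudo_hyp (l / of_real R) (m / of_real R)) \<longlongrightarrow> pseudo_hyp l m) (at_left 1)"
    unfolding pseudo_hyp_def by (auto intro!: tendsto_eq_intros)
  have "t * (1 + s * pseudo_hyp l m) \<le> s + pseudo_hyp l m"
  proof (rule tendsto_le[of "at_left (1::real)"])
    show "((\<lambda>R. t * (1 + s * pseudo_hyp (l / of_real R) (m / of_real R))) \<longlongrightarrow> t * (1 + s * pseudo_hyp l m)) (at_left 1)"
      by (intro tendsto_intros lim)
    show "((\<lambda>R. s + pseudo_hyp (l / of_real R) (m / of_real R)) \<longlongrightarrow> s + pseudo_hyp l m) (at_left 1)"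
      by (intro tendsto_intros lim)
    show "\<forall>\<^sub>F R in at_left 1. t * (1 + s * pseudo_hyp (l / of_real R) (m / of_real R))
        \<le> s + pseudo_hyp (l / of_real R) (m / of_real R)"
      using ev by eventually_elim (use * in \<open>auto simp: hyp_step_def\<close>)
  qed simp
  moreover have "0 \<le> s" "s \<le> 1" "0 \<le> t" "t \<le> 1"
    using le l m by (auto simp: s_def t_def intro!: prod_nonneg)
  ultimately show ?thesis by (simp add: hyp_step_def s_def t_def)
qed

lemma artanh_weighted_prod_le_poincare_dist:
  fixes F :: "'j \<Rightarrow> complex \<Rightarrow> complex"
  assumes "finite J" "\<And>j. j \<in> J \<Longrightarrow> F j holomorphic_on ball 0 1"
    and "\<And>j. j \<in> J \<Longrightarrow> 1 \<le> a j \<or> (\<forall>z\<in>ball 0 1. F j z \<noteq> 0)"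
    and lt: "\<And>z. z \<in> ball 0 1 \<Longrightarrow> (\<Prod>j\<in>J. cmod (F j z) powr a j) < 1"
    and l: "l \<in> ball 0 1" and m: "m \<in> ball 0 1"
  shows "artanh (\<Prod>j\<in>J. cmod (F j m) powr a j) - artanh (\<Prod>j\<in>J. cmod (F j l) powr a j) \<le> poincare_dist l m"
proof -
  have "hyp_step (pseudo_hyp l m) (\<Prod>j\<in>J. cmod (F j l) powr a j) (\<Prod>j\<in>J. cmod (F j m) powr a j)"
    using assms by (intro hyp_step_weighted_prod) (auto intro: less_imp_le)
  then show ?thesis
    using pseudo_hyp_bounds[OF l m] lt[OF l] lt[OF m]
    by (subst (asm) hyp_step_artanh) (auto simp: poincare_dist_def pseudo_hyp_def intro!: prod_nonneg)
qed

section \<open>Logarithmic convexity\<close>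

lemma holomorphic_mean_value:
  assumes "g holomorphic_on cball 0 r" "0 < r"
  shows "((\<lambda>t. g (of_real r * cis t)) has_integral 2 * of_real pi * g 0) {0..2 * pi}"
proof -
  have "((\<lambda>u. g u / (u - 0)) has_contour_integral 2 * of_real pi * \<i> * g 0) (circlepath 0 r)"
    using assms by (intro Cauchy_integral_circlepath_simple) auto
  then have "((\<lambda>t. g (0 + of_real r * cis t) / (0 + of_real r * cis t - 0) * of_real r * \<i> * cis t)
      has_integral 2 * of_real pi * \<i> * g 0) {0..2 * pi}"
    unfolding circlepath_def by (subst (asm) has_contour_integral_part_circlepath_iff) (auto simp: mult_ac)
  then have "((\<lambda>t. g (of_real r * cis t) * \<i>) has_integral 2 * of_real pi * \<i> * g 0) {0..2 * pi}"
    using assms(2) by (simp add: mult_ac)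
  from has_integral_mult_right[OF this, of "- \<i>"] show ?thesis
    by (simp add: mult_ac)
qed

lemma has_integral_cos_squared: "((\<lambda>t. cos t ^ 2) has_integral pi) {0..2 * pi}"
proof -
  have "((\<lambda>t. cos t ^ 2) has_integral (2 * pi / 2 + sin (2 * (2 * pi)) / 4) - (0 / 2 + sin (2 * 0) / 4)) {0..2 * pi}"
  proof (rule fundamental_theorem_of_calculus)
    fix t :: real
    have "((\<lambda>t. t / 2 + sin (2 * t) / 4) has_real_derivative cos t ^ 2) (at t within {0..2 * pi})"
      using cos_double_cos[of t] by (auto intro!: derivative_eq_intros simp: field_simps)
    then show "((\<lambda>t. t / 2 + sin (2 * t) / 4) has_vector_derivative cos t ^ 2) (at t within {0..2 * pi})"
      by (rule has_real_derivative_iff_has_vector_derivative[THEN iffD1])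
  qed simp
  moreover have "sin (2 * (2 * pi)) = 0"
    using sin_npi[of 4] by (simp add: mult.commute)
  ultimately show ?thesis by simp
qed

text \<open>In the mean over the circle of radius \<open>r\<close> the harmonic part contributes
  \<open>w 0\<close>, the quadratic term \<open>- M * r^2 / 2\<close> and the remainder
  \<open>C * r^3\<close>. For small \<open>r\<close> the mean falls below \<open>w 0\<close>,
  against the sub-mean value inequality.\<close>

lemma subharmonic_not_touched_from_above:
  assumes sh: "subharmonic_on S w" and S: "open S" "0 \<in> S" and g: "g holomorphic_on T" "open T" "0 \<in> T"
    and 0: "w 0 = Re (g 0)" and M: "0 < M" and r0: "0 < r0"
    and le: "\<And>l. cmod l < r0 \<Longrightarrow> w l \<le> Re (g l) - M * (Re l)\<^sup>2 + C * cmod l ^ 3"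
  shows False
proof -
  have "open (S \<inter> T)" "0 \<in> S \<inter> T" using S g by auto
  then obtain r1 where r1: "0 < r1" "cball 0 r1 \<subseteq> S \<inter> T" using open_contains_cball by blast
  \<comment> \<open>\<open>r1\<close> keeps the disc in both domains, \<open>r0 / 2\<close> stays
    strictly inside the range of the estimate, and the last bound forces
    \<open>2 * C * r < M\<close> for either sign of \<open>C\<close>.\<close>
  define r where "r = Min {r1, r0 / 2, M / (4 * (\<bar>C\<bar> + 1))}"
  have r: "0 < r" "r \<le> r1" "r < r0" "r \<le> M / (4 * (\<bar>C\<bar> + 1))"
    using r1 r0 M by (auto simp: r_def)
  have sub: "cball 0 r \<subseteq> S" "cball 0 r \<subseteq> T" using r r1 by force+
  have rC: "2 * C * r < M"
  proof -
    have "r * (4 * (\<bar>C\<bar> + 1)) \<le> M" using r(4) by (simp add: pos_le_divide_eq)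
    then have "4 * (\<bar>C\<bar> * r) + 4 * r \<le> M" by (simp add: algebra_simps)
    moreover have "C * r \<le> \<bar>C\<bar> * r" using r(1) by (intro mult_right_mono) auto
    moreover have "0 \<le> \<bar>C\<bar> * r" using r(1) by simp
    ultimately show ?thesis using r(1) by linarith
  qed
  have sm: "(\<lambda>t. w (0 + of_real r * cis t)) integrable_on {0..2 * pi}"
      "w 0 \<le> 1 / (2 * pi) * integral {0..2 * pi} (\<lambda>t. w (0 + of_real r * cis t))"
    using sh sub(1) r(1) unfolding subharmonic_on_def by blast+
  have I1: "((\<lambda>t. Re (g (of_real r * cis t))) has_integral 2 * pi * Re (g 0)) {0..2 * pi}"
    using has_integral_Re[OF holomorphic_mean_value[OF holomorphic_on_subset[OF g(1) sub(2)] r(1)]] by simp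
  have I2: "((\<lambda>t. - (M * r\<^sup>2 * cos t ^ 2)) has_integral - (M * r\<^sup>2 * pi)) {0..2 * pi}"
    by (intro has_integral_neg has_integral_mult_right has_integral_cos_squared)
  have I3: "((\<lambda>t. C * r ^ 3) has_integral 2 * pi * (C * r ^ 3)) {0..2 * pi}"
    using has_integral_const_real[of "C * r ^ 3" 0 "2 * pi"] by simp
  have I: "((\<lambda>t. Re (g (of_real r * cis t)) + - (M * r\<^sup>2 * cos t ^ 2) + C * r ^ 3) has_integral
      2 * pi * Re (g 0) + - (M * r\<^sup>2 * pi) + 2 * pi * (C * r ^ 3)) {0..2 * pi}"
    by (intro has_integral_add I1 I2 I3)
  have "integral {0..2 * pi} (\<lambda>t. w (0 + of_real r * cis t))
      \<le> 2 * pi * Re (g 0) + - (M * r\<^sup>2 * pi) + 2 * pi * (C * r ^ 3)"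
  proof (rule has_integral_le[OF integrable_integral[OF sm(1)] I])
    fix t
    have "cmod (of_real r * cis t) = r" using r(1) by (simp add: norm_mult)
    then show "w (0 + of_real r * cis t) \<le> Re (g (of_real r * cis t)) + - (M * r\<^sup>2 * cos t ^ 2) + C * r ^ 3"
      using le[of "of_real r * cis t"] r by (simp add: power_mult_distrib)
  qed
  moreover have "2 * pi * w 0 \<le> integral {0..2 * pi} (\<lambda>t. w (0 + of_real r * cis t))"
    using sm(2) by (simp add: field_simps)
  ultimately have "2 * pi * Re (g 0) \<le> 2 * pi * Re (g 0) + - (M * r\<^sup>2 * pi) + 2 * pi * (C * r ^ 3)"
    unfolding 0 by linarith
  then have "(pi * r\<^sup>2) * M \<le> (pi * r\<^sup>2) * (2 * C * r)"
    by (simp add: power2_eq_square power3_eq_cube mult_ac)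
  then have "M \<le> 2 * C * r"
    using r(1) by (subst (asm) mult_le_cancel_left_pos) auto
  with rC show False by simp
qed

section \<open>Reinhardt symmetry and logarithmic coordinates\<close>

text \<open>Coordinatewise rotations are isometries whose inverses are again rotations, so they
  preserve \<open>D\<close>, its closure and its complement. The reverse inequality between the
  distances comes from applying the result to the inverse.\<close>

lemma reinhardt_rotate:
  fixes D :: "(complex ^ 'n) set" and l :: "complex ^ 'n"
  assumes D: "reinhardt_domain D" and l: "\<And>j. cmod (l $ j) = 1"
  shows "z \<in> D \<Longrightarrow> (\<chi> j. l $ j * z $ j) \<in> D"
    and "z \<in> frontier D \<Longrightarrow> (\<chi> j. l $ j * z $ j) \<in> frontier D"
    and "dist_bdry D (\<chi> j. l $ j * z $ j) \<le> dist_bdry D z"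
proof -
  have inD: "(\<chi> j. k $ j * y $ j) \<in> D" if "y \<in> D" "\<And>j. cmod (k $ j) = 1" for k y :: "complex ^ 'n"
    using D that unfolding reinhardt_domain_def by blast
  then show "z \<in> D \<Longrightarrow> (\<chi> j. l $ j * z $ j) \<in> D" using l by blast
  have op: "open D" using D by (simp add: reinhardt_domain_def is_domain_def)
  have iso: "dist (\<chi> j. l $ j * x $ j) (\<chi> j. l $ j * y $ j) = dist x y" for x y :: "complex ^ 'n"
  proof -
    have "dist (l $ j * x $ j) (l $ j * y $ j) = dist (x $ j) (y $ j)" for j
      using l[of j] norm_mult[of "l $ j" "x $ j - y $ j"] by (simp add: dist_norm right_diff_distrib)
    then show ?thesis by (simp add: dist_vec_def)
  qed
  have inv: "(\<chi> j. inverse (l $ j) * (\<chi> j. l $ j * y $ j) $ j) = y" for y :: "complex ^ 'n"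
  proof -
    have "l $ j \<noteq> 0" for j using l[of j] by auto
    then show ?thesis by (simp add: vec_eq_iff)
  qed
  show fr: "(\<chi> j. l $ j * z $ j) \<in> frontier D" if z: "z \<in> frontier D" for z
  proof -
    have z: "z \<in> closure D" "z \<notin> D" using z op by (auto simp: frontier_def interior_open)
    have "(\<chi> j. l $ j * z $ j) \<in> closure D"
      unfolding closure_approachable
    proof (intro allI impI)
      fix e :: real assume "0 < e"
      then obtain y where "y \<in> D" "dist y z < e" using z(1) unfolding closure_approachable by blast
      then show "\<exists>y\<in>D. dist y (\<chi> j. l $ j * z $ j) < e"
        using inD[OF _ l] iso by (intro bexI[of _ "\<chi> j. l $ j * y $ j"]) auto
    qed
    moreover have "(\<chi> j. l $ j * z $ j) \<notin> D"
    proof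
      assume "(\<chi> j. l $ j * z $ j) \<in> D"
      then have "(\<chi> j. (\<chi> j. inverse (l $ j)) $ j * (\<chi> j. l $ j * z $ j) $ j) \<in> D"
        by (rule inD) (simp add: norm_inverse l)
      then show False using z(2) inv[of z] by simp
    qed
    ultimately show ?thesis using op by (simp add: frontier_def interior_open)
  qed
  show "dist_bdry D (\<chi> j. l $ j * z $ j) \<le> dist_bdry D z"
  proof (cases "frontier D = {}")
    case False
    then show ?thesis
      unfolding infdist_notempty[OF False, of z]
    proof (rule cINF_greatest)
      fix p assume "p \<in> frontier D"
      from fr[OF this] show "dist_bdry D (\<chi> j. l $ j * z $ j) \<le> dist z p"
        using infdist_le iso by metis
    qed
  qed (simp add: infdist_def)
qed

lemma reinhardt_same_modulus:
  fixes D :: "(complex ^ 'n) set"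
  assumes D: "reinhardt_domain D" and eq: "\<And>j. cmod (w $ j) = cmod (z $ j)"
  shows "w \<in> D \<longleftrightarrow> z \<in> D" and "dist_bdry D w = dist_bdry D z"
proof -
  have *: "\<exists>l :: complex ^ 'n. (\<forall>j. cmod (l $ j) = 1) \<and> w = (\<chi> j. l $ j * z $ j)"
    if "\<And>j. cmod (w $ j) = cmod (z $ j)" for w z :: "complex ^ 'n"
  proof (intro exI conjI allI)
    \<comment> \<open>Where \<open>z\<close> vanishes the phase is free; the value 1 keeps the
      factor unimodular, whereas division by 0 would give 0.\<close>
    let ?l = "(\<chi> j. if z $ j = 0 then 1 else w $ j / z $ j) :: complex ^ 'n"
    show "cmod (?l $ j) = 1" for j using that[of j] by (auto simp: norm_divide)
    have "w $ j = 0" if "z $ j = 0" for j using \<open>\<And>j. cmod (w $ j) = cmod (z $ j)\<close>[of j] that by simp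
    then show "w = (\<chi> j. ?l $ j * z $ j)" by (auto simp: vec_eq_iff)
  qed
  have "(z \<in> D \<longrightarrow> w \<in> D) \<and> dist_bdry D w \<le> dist_bdry D z"
    if "\<And>j. cmod (w $ j) = cmod (z $ j)" for w z :: "complex ^ 'n"
    using *[OF that] reinhardt_rotate(1,3)[OF D] by metis
  from this[of w z] this[of z w] eq show "w \<in> D \<longleftrightarrow> z \<in> D" "dist_bdry D w = dist_bdry D z"
    by auto
qed

definition exp_vec :: "real ^ 'n \<Rightarrow> complex ^ 'n" where
  "exp_vec x = (\<chi> j. of_real (exp (x $ j)))"

text \<open>For a Reinhardt domain it is enough to test the positive point \<open>exp_vec x\<close>:
  this is the classical set of all vectors of \<open>ln (cmod (z $ j))\<close> over points of
  \<open>D\<close> without zero coordinates.\<close>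

definition log_image :: "(complex ^ 'n) set \<Rightarrow> (real ^ 'n) set" where
  "log_image D = {x. exp_vec x \<in> D}"

lemma continuous_on_exp_vec: "continuous_on A exp_vec"
  unfolding exp_vec_def by (intro continuous_intros)

lemma open_log_image: "open D \<Longrightarrow> open (log_image D)"
  unfolding log_image_def using open_vimage[OF _ continuous_on_exp_vec] by (simp add: vimage_def)

section \<open>The boundary distance in logarithmic coordinates\<close>

lemma norm_vec_le_sum: "norm x \<le> (\<Sum>j\<in>UNIV. norm (x $ j))"
  unfolding norm_vec_def by (intro L2_set_le_sum) auto

lemma dist_bdry_pos:
  assumes "open D" "frontier D \<noteq> {}" "z \<in> D"
  shows "0 < dist_bdry D z"
  using assms by (metis frontier_closed frontier_disjoint_eq disjoint_iff in_closed_iff_infdist_zero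
      infdist_nonneg less_eq_real_def)

text \<open>Plurisubharmonicity is only available on complex lines, whereas convexity in logarithmic
  coordinates concerns the curves \<open>l \<mapsto> (a\<^sub>j exp (b\<^sub>j l))\<close>. On the tangent line \<open>l \<mapsto> (a\<^sub>j (1 + b\<^sub>j l))\<close> the
  logarithmic coordinates are \<open>Re (Ln (1 + b\<^sub>j l)) = b\<^sub>j Re l + O(\<bar>l\<bar>\<^sup>2)\<close>, a harmonic function, so a smooth
  test function that touches from above still cannot be strictly concave in the direction \<open>b\<close>.\<close>

lemma log_dist_not_touched_from_above:
  fixes D :: "(complex ^ 'n) set" and A b z :: "real ^ 'n"
  defines "v \<equiv> \<lambda>x. - ln (dist_bdry D (exp_vec x))"
  assumes D: "reinhardt_domain D" and pc: "pseudoconvex D" and z: "z \<in> log_image D"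
    and b: "norm b = 1" and M: "0 < M" and K: "0 \<le> K" and r0: "0 < r0"
    and le: "\<And>h. norm h < r0 \<Longrightarrow> v (z + h) \<le> v z + A \<bullet> h + K * (h \<bullet> h) - (K + M) * (h \<bullet> b)\<^sup>2"
  shows False
proof -
  define a where "a = exp_vec z"
  define c :: "complex ^ 'n" where "c = (\<chi> j. a $ j * of_real (b $ j))"
  define S where "S = {l. a + l *s c \<in> D}"
  define w where "w l = - ln (dist_bdry D (a + l *s c))" for l
  \<comment> \<open>\<open>H l\<close> is the logarithmic displacement along the complex line, and
    \<open>g\<close> is holomorphic with real part \<open>v z + A \<bullet> H l\<close>: the linear
    part of the test function becomes harmonic in \<open>l\<close>.\<close>
  define H :: "complex \<Rightarrow> real ^ 'n" where "H l = (\<chi> j. Re (Ln (1 + of_real (b $ j) * l)))" for l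
  define g where "g l = of_real (v z) + (\<Sum>j\<in>UNIV. of_real (A $ j) * Ln (1 + of_real (b $ j) * l))" for l
  define n where "n = real CARD('n)"
  \<comment> \<open>Collects the errors of third order: the mixed term, where the deviation from
    \<open>Re l *\<^sub>R b\<close> is at most \<open>2 * n * (cmod l)^2\<close>, and the square of
    this deviation, of fourth order.\<close>
  define C where "C = 2 * M * (2 * n) + K * (2 * n)\<^sup>2"
  have aD: "a \<in> D" using z by (simp add: a_def log_image_def)
  have b1: "\<bar>b $ j\<bar> \<le> 1" for j
    using component_le_norm_cart[of b j] b by simp
  have bl: "cmod (of_real (b $ j) * l) \<le> cmod l" for j l
    using b1[of j] by (simp add: norm_mult mult_left_le_one_le)
  have nz: "1 + of_real (b $ j) * l \<noteq> 0" "1 + of_real (b $ j) * l \<notin> \<real>\<^sub>\<le>\<^sub>0" if "cmod l < 1" for j l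
  proof -
    have "cmod (of_real (b $ j) * l) < 1" using bl[of j l] that by linarith
    then have "0 < Re (1 + of_real (b $ j) * l)"
      using abs_Re_le_cmod[of "of_real (b $ j) * l"] by simp
    then show "1 + of_real (b $ j) * l \<notin> \<real>\<^sub>\<le>\<^sub>0"
      by (auto simp: complex_nonpos_Reals_iff)
    then show "1 + of_real (b $ j) * l \<noteq> 0" by auto
  qed
  have sh: "subharmonic_on S w"
    using pc aD unfolding pseudoconvex_def plurisubharmonic_on_def S_def w_def by blast
  have "continuous_on UNIV (\<lambda>l. a + l *s c)"
    unfolding vector_scalar_mult_def by (intro continuous_intros)
  then have oS: "open S"
    using open_vimage[of D "\<lambda>l. a + l *s c"] D
    by (simp add: S_def vimage_def reinhardt_domain_def is_domain_def)
  have S0: "0 \<in> S" using aD by (simp add: S_def)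
  have wv: "w l = v (z + H l)" if "cmod l < 1" for l
    unfolding w_def v_def
  proof (subst reinhardt_same_modulus(2)[OF D])
    fix j
    have "(a + l *s c) $ j = of_real (exp (z $ j)) * (1 + of_real (b $ j) * l)"
      by (simp add: a_def c_def exp_vec_def algebra_simps)
    then show "cmod ((a + l *s c) $ j) = cmod (exp_vec (z + H l) $ j)"
      using nz[OF that, of j] by (simp add: norm_mult exp_vec_def H_def exp_add)
  qed simp
  have gH: "Re (g l) = v z + A \<bullet> H l" for l
    by (simp add: g_def inner_vec_def H_def)
  have ghol: "g holomorphic_on ball 0 1"
    unfolding g_def using nz by (intro holomorphic_intros) auto
  have n1: "1 \<le> n" unfolding n_def using one_le_card_finite[where 'a = 'n] by simp
  have Hb: "norm (H l - Re l *\<^sub>R b) \<le> 2 * n * (cmod l)\<^sup>2" if l: "cmod l \<le> 1 / 2" for l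
  proof -
    have "\<bar>(H l - Re l *\<^sub>R b) $ j\<bar> \<le> 2 * (cmod l)\<^sup>2" for j
    proof -
      let ?w = "of_real (b $ j) * l"
      have w: "cmod ?w \<le> 1 / 2" using bl[of j l] l by linarith
      have "\<bar>(H l - Re l *\<^sub>R b) $ j\<bar> = \<bar>Re (Ln (1 + ?w) - ?w)\<bar>"
        by (simp add: H_def mult.commute)
      also have "\<dots> \<le> cmod (Ln (1 + ?w) - ?w)" by (rule abs_Re_le_cmod)
      also have "\<dots> \<le> (cmod ?w)\<^sup>2 / (1 - cmod ?w)"
        using w by (intro Ln_approx_linear) auto
      also have "\<dots> \<le> (cmod l)\<^sup>2 / (1 / 2)"
        using w bl[of j l] by (intro frac_le power_mono) auto
      finally show ?thesis by simp
    qed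
    then have "(\<Sum>j\<in>UNIV. norm ((H l - Re l *\<^sub>R b) $ j)) \<le> (\<Sum>j\<in>(UNIV::'n set). 2 * (cmod l)\<^sup>2)"
      unfolding real_norm_def by (rule sum_mono)
    also have "\<dots> = 2 * n * (cmod l)\<^sup>2" by (simp add: n_def)
    finally show ?thesis using norm_vec_le_sum order_trans by blast
  qed
  have Hn: "norm (H l) \<le> (1 + n) * cmod l" if l: "cmod l \<le> 1 / 2" for l
  proof -
    have "norm (H l) \<le> norm (H l - Re l *\<^sub>R b) + norm (Re l *\<^sub>R b)"
      using norm_triangle_ineq[of "H l - Re l *\<^sub>R b" "Re l *\<^sub>R b"] by simp
    moreover have "norm (Re l *\<^sub>R b) \<le> cmod l" using b abs_Re_le_cmod by simp
    moreover have "2 * n * (cmod l)\<^sup>2 \<le> n * cmod l"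
      using l n1 mult_right_mono[of "2 * cmod l" 1 "cmod l"] by (simp add: power2_eq_square mult_left_mono)
    ultimately show ?thesis using Hb[OF l] by (simp add: algebra_simps)
  qed
  show False
  proof (rule subharmonic_not_touched_from_above[OF sh oS S0 ghol _ _ _ M, of "min (1/2) (r0 / (1 + n))" C])
    show "w 0 = Re (g 0)" using wv[of 0] gH[of 0] by (simp add: H_def zero_vec_def[symmetric])
    show "0 < min (1/2) (r0 / (1 + n))" using r0 n1 by simp
    fix l assume "cmod l < min (1/2) (r0 / (1 + n))"
    then have l: "cmod l < 1 / 2" "cmod l * (1 + n) < r0"
      using n1 by (auto simp: pos_less_divide_eq)
    define t e where "t = Re l" and "e = H l - t *\<^sub>R b"
    have H: "H l = t *\<^sub>R b + e" by (simp add: e_def)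
    have bb: "b \<bullet> b = 1" using b by (simp add: dot_square_norm)
    have en: "norm e \<le> 2 * n * (cmod l)\<^sup>2" unfolding e_def t_def using Hb l by simp
    have be: "\<bar>b \<bullet> e\<bar> \<le> 2 * n * (cmod l)\<^sup>2" using Cauchy_Schwarz_ineq2[of b e] b en by simp
    have wl: "w l \<le> v z + A \<bullet> H l + K * (H l \<bullet> H l) - (K + M) * (H l \<bullet> b)\<^sup>2"
      using le[of "H l"] Hn[of l] l wv[of l] by (simp add: mult.commute)
    \<comment> \<open>Along the unit vector \<open>b\<close> the terms \<open>K * t^2\<close>
      cancel, and at second order only \<open>- M * t^2\<close> survives.\<close>
    have "K * (H l \<bullet> H l) - (K + M) * (H l \<bullet> b)\<^sup>2
        = - M * t\<^sup>2 - 2 * M * t * (b \<bullet> e) + K * (e \<bullet> e) - (K + M) * (b \<bullet> e)\<^sup>2"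
      unfolding H by (simp add: inner_add_left inner_add_right bb inner_commute[of e b] power2_eq_square algebra_simps)
    also have "\<dots> \<le> - M * t\<^sup>2 + C * cmod l ^ 3"
    proof -
      have "\<bar>t * (b \<bullet> e)\<bar> \<le> cmod l * (2 * n * (cmod l)\<^sup>2)"
        unfolding abs_mult t_def using be abs_Re_le_cmod by (intro mult_mono) auto
      then have "- (t * (b \<bullet> e)) \<le> 2 * n * cmod l ^ 3"
        by (simp add: power2_eq_square power3_eq_cube abs_le_iff mult_ac)
      then have 1: "- 2 * M * t * (b \<bullet> e) \<le> 2 * M * (2 * n) * cmod l ^ 3"
        using mult_left_mono[of "- (t * (b \<bullet> e))" "2 * n * cmod l ^ 3" "2 * M"] M by (simp add: mult_ac)
      have "e \<bullet> e \<le> (2 * n * (cmod l)\<^sup>2)\<^sup>2"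
        unfolding dot_square_norm using en by (intro power_mono) auto
      also have "\<dots> = (2 * n)\<^sup>2 * (cmod l ^ 3 * cmod l)"
        by (simp add: power_mult_distrib power2_eq_square power3_eq_cube)
      also have "\<dots> \<le> (2 * n)\<^sup>2 * (cmod l ^ 3 * 1)"
        using l by (intro mult_left_mono) auto
      finally have 2: "K * (e \<bullet> e) \<le> K * (2 * n)\<^sup>2 * cmod l ^ 3"
        using K mult_left_mono by (fastforce simp: mult.assoc)
      have 3: "0 \<le> (K + M) * (b \<bullet> e)\<^sup>2" using K M by simp
      show ?thesis using 1 2 3 unfolding C_def by (simp add: algebra_simps)
    qed
    finally show "w l \<le> Re (g l) - M * (Re l)\<^sup>2 + C * cmod l ^ 3"
      using wl unfolding gH t_def by simp
  qed auto
qed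

text \<open>Quasiconcavity of the boundary distance on segments already known to lie in the
  logarithmic image. A violation at \<open>p\<close> yields a quadratic function that touches
  \<open>v\<close> from above and is strictly concave along the segment, which
  \<open>log_dist_not_touched_from_above\<close> excludes.\<close>

lemma dist_bdry_segment_ge:
  fixes D :: "(complex ^ 'n) set" and x y :: "real ^ 'n"
  assumes D: "reinhardt_domain D" and pc: "pseudoconvex D" and fr: "frontier D \<noteq> {}"
    and seg: "closed_segment x y \<subseteq> log_image D" and p: "p \<in> closed_segment x y"
  shows "min (dist_bdry D (exp_vec x)) (dist_bdry D (exp_vec y)) \<le> dist_bdry D (exp_vec p)"
proof (rule ccontr)
  define d where "d = (\<lambda>x. dist_bdry D (exp_vec x))"
  define v where "v = (\<lambda>x. - ln (d x))"
  assume "\<not> min (dist_bdry D (exp_vec x)) (dist_bdry D (exp_vec y)) \<le> dist_bdry D (exp_vec p)"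
  then have dp: "d p < d x" "d p < d y" by (auto simp: d_def)
  have oD: "open D" using D by (simp add: reinhardt_domain_def is_domain_def)
  have dpos: "0 < d u" if "u \<in> log_image D" for u
    using dist_bdry_pos[OF oD fr] that by (simp add: d_def log_image_def)
  have contd: "continuous_on UNIV d"
    unfolding d_def by (intro continuous_on_infdist continuous_on_exp_vec)
  have contv: "continuous_on (log_image D) v"
    unfolding v_def using dpos
    by (intro continuous_intros continuous_on_subset[OF contd]) (auto simp: less_imp_neq[symmetric])
  have pL: "p \<in> log_image D" "x \<in> log_image D" "y \<in> log_image D" using seg p by auto
  have vp: "v x < v p" "v y < v p" using dp dpos[OF pL(1)] by (auto simp: v_def)
  define L where "L = norm (y - x)"
  have "x \<noteq> y" using p dp by auto
  then have L: "0 < L" by (simp add: L_def)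
  define b where "b = (y - x) /\<^sub>R L"
  have b: "norm b = 1" using L by (simp add: b_def L_def)
  have bb: "b \<bullet> b = 1" using b by (simp add: dot_square_norm)
  have yb: "y = x + L *\<^sub>R b" using L by (simp add: b_def)
  \<comment> \<open>\<open>s z\<close> is the signed length along the line from \<open>x\<close>
    towards \<open>y\<close>, and \<open>N z\<close> the squared distance from this line.\<close>
  define s where "s z = (z - x) \<bullet> b" for z
  define N where "N z = (z - x) \<bullet> (z - x) - (s z)\<^sup>2" for z
  have Nnorm: "N z = (norm (z - (x + s z *\<^sub>R b)))\<^sup>2" for z
    unfolding N_def power2_norm_eq_inner s_def
    by (simp add: inner_diff_left inner_diff_right inner_add_left inner_add_right bb inner_commute power2_eq_square algebra_simps)
  have line: "x + t *\<^sub>R b \<in> closed_segment x y" if "0 \<le> t" "t \<le> L" for t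
    unfolding closed_segment_def using that L
    by (auto intro!: exI[of _ "t / L"] simp: yb algebra_simps)
  define m where "m = max (v x) (v y)"
  define M0 where "M0 = v p - m"
  have M0: "0 < M0" using vp by (simp add: M0_def m_def)
  define c where "c = M0 / L\<^sup>2"
  have c: "0 < c" using M0 L by (simp add: c_def)
  obtain \<delta>1 where \<delta>1: "0 < \<delta>1" "(\<Union>u\<in>closed_segment x y. ball u \<delta>1) \<subseteq> log_image D"
    using compact_subset_open_imp_ball_epsilon_subset[OF compact_segment open_log_image[OF oD] seg]
    by metis
  have near: "\<exists>\<delta>>0. \<forall>z. dist z u < \<delta> \<longrightarrow> v z < m + M0 / 4" if u: "u \<in> log_image D" "v u \<le> m" for u
  proof -
    have "isCont v u"
      using contv u(1) open_log_image[OF oD] continuous_on_eq_continuous_at by blast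
    then have "\<forall>\<^sub>F z in at u. v z < m + M0 / 4"
      using u(2) M0 by (intro order_tendstoD(2)[of v "v u"]) (auto simp: isCont_def)
    then obtain \<delta> where "0 < \<delta>" "\<And>z. z \<noteq> u \<Longrightarrow> dist z u < \<delta> \<Longrightarrow> v z < m + M0 / 4"
      by (auto simp: eventually_at)
    then show ?thesis using u(2) M0 by (metis add_strict_increasing2 divide_pos_pos le_less_trans less_add_same_cancel1 zero_less_numeral)
  qed
  obtain \<delta>2 where \<delta>2: "0 < \<delta>2" "\<And>z. dist z x < \<delta>2 \<Longrightarrow> v z < m + M0 / 4"
    using near[OF pL(2)] by (auto simp: m_def)
  obtain \<delta>3 where \<delta>3: "0 < \<delta>3" "\<And>z. dist z y < \<delta>3 \<Longrightarrow> v z < m + M0 / 4"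
    using near[OF pL(3)] by (auto simp: m_def)
  define \<delta> where "\<delta> = min \<delta>1 (min \<delta>2 \<delta>3) / 2"
  have \<delta>: "0 < \<delta>" "\<delta> < \<delta>1" "\<delta> < \<delta>2" "\<delta> < \<delta>3" using \<delta>1 \<delta>2 \<delta>3 by (auto simp: \<delta>_def)
  \<comment> \<open>A counterexample \<open>p\<close> makes \<open>v\<close> minus a quadratic polynomial, concave along the segment and steep
    across it, attain its maximum over a thin tube \<open>T\<close> in the interior of the tube.\<close>
  define T where "T = {z. 0 \<le> s z \<and> s z \<le> L \<and> N z \<le> \<delta>\<^sup>2}"
  have close: "dist z (x + s z *\<^sub>R b) \<le> \<delta>" if "N z \<le> \<delta>\<^sup>2" for z
    using that \<delta>(1) unfolding Nnorm dist_norm by (simp add: abs_le_square_iff[symmetric])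
  have TL: "T \<subseteq> log_image D"
  proof
    fix z assume "z \<in> T"
    then have z: "0 \<le> s z" "s z \<le> L" "N z \<le> \<delta>\<^sup>2" by (auto simp: T_def)
    have "z \<in> ball (x + s z *\<^sub>R b) \<delta>1" using close[OF z(3)] \<delta> by (simp add: dist_commute)
    then show "z \<in> log_image D" using line[OF z(1,2)] \<delta>1(2) by blast
  qed
  have conts: "continuous_on A s" and contN: "continuous_on A N" for A
    unfolding s_def N_def by (intro continuous_intros)+
  have "closed T"
    unfolding T_def
    by (intro closed_Collect_conj closed_Collect_le conts contN continuous_intros)
  moreover have "bounded T"
  proof -
    obtain R where R: "\<And>u. u \<in> closed_segment x y \<Longrightarrow> norm u \<le> R"
      using bounded_closed_segment[of x y] unfolding bounded_iff by blast
    have "norm z \<le> R + \<delta>" if "z \<in> T" for z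
    proof -
      have "norm (x + s z *\<^sub>R b) \<le> R" "norm (z - (x + s z *\<^sub>R b)) \<le> \<delta>"
        using that line R close by (auto simp: T_def dist_norm)
      then show ?thesis using norm_triangle_sub[of z "x + s z *\<^sub>R b"] by linarith
    qed
    then show ?thesis by (rule boundedI)
  qed
  ultimately have cT: "compact T" by (simp add: compact_eq_bounded_closed)
  have sp: "0 \<le> s p" "s p \<le> L" "N p = 0"
  proof -
    obtain u where u: "0 \<le> u" "u \<le> 1" "p = (1 - u) *\<^sub>R x + u *\<^sub>R y"
      using p by (auto simp: closed_segment_def)
    have "p - x = (u * L) *\<^sub>R b" unfolding u(3) yb by (simp add: algebra_simps)
    then have "s p = u * L" "N p = 0" by (simp_all add: s_def N_def bb power2_eq_square)
    then show "0 \<le> s p" "s p \<le> L" "N p = 0" using u L by (auto simp: mult_left_le_one_le)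
  qed
  have pT: "p \<in> T" using sp by (simp add: T_def)
  obtain V where V: "\<And>z. z \<in> T \<Longrightarrow> v z \<le> V"
    using continuous_attains_sup[OF cT _ continuous_on_subset[OF contv TL]] pT by blast
  \<comment> \<open>The penalty \<open>K * N z\<close> reaches \<open>\<bar>V - m\<bar> + 1\<close>
    on the lateral surface of the tube, which makes \<open>f\<close> negative there.\<close>
  define K where "K = (\<bar>V - m\<bar> + 1) / \<delta>\<^sup>2"
  have K: "0 \<le> K" "K * \<delta>\<^sup>2 = \<bar>V - m\<bar> + 1" using \<delta> by (auto simp: K_def)
  \<comment> \<open>For \<open>0 \<le> t \<le> L\<close> the arch \<open>q\<close> lies between
    \<open>m + M0 / 4\<close> and \<open>m + M0 / 2\<close>: above \<open>v\<close> near both ends,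
    but at least \<open>M0 / 2\<close> below \<open>v p = m + M0\<close>. The choice
    \<open>c = M0 / L^2\<close> gives the arch the height \<open>M0 / 4\<close>.\<close>
  define q where "q t = m + M0 / 4 + c * (t * (L - t))" for t
  define f where "f z = v z - q (s z) - K * N z" for z
  have qle: "q t \<le> m + M0 / 2" for t
  proof -
    have "0 \<le> (L - 2 * t)\<^sup>2" by simp
    then have "t * (L - t) \<le> L\<^sup>2 / 4" by (simp add: power2_eq_square algebra_simps)
    then have "c * (t * (L - t)) \<le> c * (L\<^sup>2 / 4)" using c by (intro mult_left_mono) auto
    also have "\<dots> = M0 / 4" using L by (simp add: c_def)
    finally show ?thesis by (simp add: q_def)
  qed
  have qge: "m + M0 / 4 \<le> q t" if "0 \<le> t" "t \<le> L" for t
    using that c by (simp add: q_def)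
  have "continuous_on T f"
    unfolding f_def q_def
    by (intro continuous_intros conts contN continuous_on_subset[OF contv TL])
  then obtain z where z: "z \<in> T" "\<And>u. u \<in> T \<Longrightarrow> f u \<le> f z"
    using continuous_attains_sup[OF cT _, of f] pT by blast
  have zs: "0 \<le> s z" "s z \<le> L" "N z \<le> \<delta>\<^sup>2" using z(1) by (auto simp: T_def)
  have N0: "0 \<le> N u" for u unfolding Nnorm by simp
  have "f p = v p - q (s p)" using sp by (simp add: f_def)
  then have "M0 / 2 \<le> f p" using qle[of "s p"] M0_def by argo
  then have fz: "0 < f z" using z(2)[OF pT] M0 by linarith
  have KN: "0 \<le> K * N z" using K N0 by simp
  have "N z \<noteq> \<delta>\<^sup>2"
  proof
    assume "N z = \<delta>\<^sup>2"
    then have "f z \<le> V - (m + M0 / 4) - (\<bar>V - m\<bar> + 1)"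
      using V[OF z(1)] qge[OF zs(1,2)] K(2) by (simp add: f_def)
    then show False using fz M0 by linarith
  qed
  moreover have "s z \<noteq> 0"
  proof
    assume "s z = 0"
    then have "dist z x \<le> \<delta>" using close[OF zs(3)] by simp
    then have "v z < m + M0 / 4" using \<delta> \<delta>2(2) by auto
    then show False using fz qge[OF zs(1,2)] KN by (simp add: f_def)
  qed
  moreover have "s z \<noteq> L"
  proof
    assume "s z = L"
    then have "dist z y \<le> \<delta>" using close[OF zs(3)] yb by simp
    then have "v z < m + M0 / 4" using \<delta> \<delta>3(2) by auto
    then show False using fz qge[OF zs(1,2)] KN by (simp add: f_def)
  qed
  ultimately have "z \<in> {z. 0 < s z \<and> s z < L \<and> N z < \<delta>\<^sup>2}" using zs by auto
  moreover have "open {z. 0 < s z \<and> s z < L \<and> N z < \<delta>\<^sup>2}"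
    by (intro open_Collect_conj open_Collect_less conts contN continuous_intros)
  ultimately obtain r0 where r0: "0 < r0" "ball z r0 \<subseteq> {z. 0 < s z \<and> s z < L \<and> N z < \<delta>\<^sup>2}"
    using open_contains_ball by blast
  \<comment> \<open>The gradient of \<open>q (s z) + K * N z\<close> at the maximum point; this
    function is quadratic, so the expansion below is exact.\<close>
  define A where "A = (c * (L - 2 * s z)) *\<^sub>R b + (2 * K) *\<^sub>R (z - x) - (2 * K * s z) *\<^sub>R b"
  show False
  proof (rule log_dist_not_touched_from_above[OF D pc _ b c K(1) r0(1), of z A])
    show "z \<in> log_image D" using z(1) TL by auto
    fix h :: "real ^ 'n" assume "norm h < r0"
    then have "z + h \<in> ball z r0" by (simp add: dist_norm)
    then have "z + h \<in> T" using r0(2) by (force simp: T_def)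
    then have "f (z + h) \<le> f z" by (rule z(2))
    then have "v (z + h) \<le> v z + (q (s (z + h)) - q (s z)) + K * (N (z + h) - N z)"
      by (simp add: f_def algebra_simps)
    also have "\<dots> = v z + A \<bullet> h + K * (h \<bullet> h) - (K + c) * (h \<bullet> b)\<^sup>2"
    proof -
      define \<sigma> where "\<sigma> = h \<bullet> b"
      have s1: "s (z + h) = s z + \<sigma>" by (simp add: s_def \<sigma>_def inner_add_left inner_diff_left)
      have N1: "N (z + h) - N z = 2 * ((z - x) \<bullet> h) + h \<bullet> h - 2 * s z * \<sigma> - \<sigma>\<^sup>2"
      proof -
        have "(z + h - x) \<bullet> (z + h - x) = (z - x) \<bullet> (z - x) + 2 * ((z - x) \<bullet> h) + h \<bullet> h"
          by (simp add: inner_diff_left inner_diff_right inner_add_left inner_add_right inner_commute)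
        then show ?thesis unfolding N_def s1 by (simp add: power2_eq_square algebra_simps)
      qed
      have A1: "A \<bullet> h = c * (L - 2 * s z) * \<sigma> + 2 * K * ((z - x) \<bullet> h) - 2 * K * s z * \<sigma>"
        unfolding A_def \<sigma>_def inner_diff_left[of _ _ h] inner_add_left[of _ _ h]
        by (simp only: inner_scaleR_left inner_diff_left inner_commute[of b h])
      show ?thesis
        unfolding N1 A1 s1 q_def \<sigma>_def[symmetric] by (simp add: power2_eq_square algebra_simps)
    qed
    finally show "- ln (dist_bdry D (exp_vec (z + h))) \<le> - ln (dist_bdry D (exp_vec z))
        + A \<bullet> h + K * (h \<bullet> h) - (K + c) * (h \<bullet> b)\<^sup>2"
      by (simp add: v_def d_def)
  qed
qed

section \<open>Connectedness and convexity of the logarithmic image\<close>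

text \<open>Boxes in the moduli also serve points with vanishing coordinates, where the logarithmic
  box extends to \<open>- \<infinity>\<close>. The point \<open>P\<close> of the moduli of
  \<open>p\<close> has a ball in \<open>D\<close>, and the boundary distance drops by at most the
  distance moved.\<close>

lemma mod_box_subset_log_image:
  fixes D :: "(complex ^ 'n) set"
  assumes D: "reinhardt_domain D" and p: "p \<in> D" and \<delta>: "\<delta> < dist_bdry D p"
  shows "\<exists>\<epsilon>>0. \<forall>x. (\<forall>j. \<bar>exp (x $ j) - cmod (p $ j)\<bar> < \<epsilon>) \<longrightarrow>
      x \<in> log_image D \<and> \<delta> \<le> dist_bdry D (exp_vec x)"
proof -
  define P :: "complex ^ 'n" where "P = (\<chi> j. of_real (cmod (p $ j)))"
  have P: "P \<in> D" "dist_bdry D P = dist_bdry D p"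
    using reinhardt_same_modulus[OF D, of P p] p by (auto simp: P_def)
  have oD: "open D" using D by (simp add: reinhardt_domain_def is_domain_def)
  obtain e where e: "0 < e" "ball P e \<subseteq> D" using oD P(1) open_contains_ball by blast
  define e' where "e' = min e (dist_bdry D p - \<delta>)"
  have e': "0 < e'" "e' \<le> e" "e' \<le> dist_bdry D p - \<delta>" using e \<delta> by (auto simp: e'_def)
  define \<epsilon> where "\<epsilon> = e' / real CARD('n)"
  have \<epsilon>: "0 < \<epsilon>" using e' by (simp add: \<epsilon>_def)
  have "x \<in> log_image D \<and> \<delta> \<le> dist_bdry D (exp_vec x)"
    if x: "\<And>j. \<bar>exp (x $ j) - cmod (p $ j)\<bar> < \<epsilon>" for x
  proof -
    have "norm (exp_vec x - P) \<le> (\<Sum>j\<in>UNIV. norm ((exp_vec x - P) $ j))" by (rule norm_vec_le_sum)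
    also have "\<dots> = (\<Sum>j\<in>UNIV. \<bar>exp (x $ j) - cmod (p $ j)\<bar>)"
      by (simp add: exp_vec_def P_def flip: of_real_diff)
    also have "\<dots> < (\<Sum>j\<in>(UNIV :: 'n set). \<epsilon>)"
      using x by (intro sum_strict_mono) auto
    also have "\<dots> = e'" by (simp add: \<epsilon>_def)
    finally have n: "dist (exp_vec x) P < e'" by (simp add: dist_norm)
    then have "exp_vec x \<in> D" using e' e by (auto simp: dist_commute)
    moreover have "dist_bdry D P \<le> dist_bdry D (exp_vec x) + dist P (exp_vec x)"
      by (rule infdist_triangle)
    ultimately show ?thesis using n e' P(2) by (simp add: log_image_def dist_commute)
  qed
  then show ?thesis using \<epsilon> by blast
qed

lemma convex_mod_box:
  fixes c :: "'n::finite \<Rightarrow> real"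
  shows "convex {x :: real ^ 'n. \<forall>j. \<bar>exp (x $ j) - c j\<bar> < \<epsilon>}"
proof -
  have "is_interval {t :: real. \<bar>exp t - c j\<bar> < \<epsilon>}" for j
    unfolding is_interval_1
  proof (intro ballI allI impI)
    fix a b t assume ab: "a \<in> {t. \<bar>exp t - c j\<bar> < \<epsilon>}" "b \<in> {t. \<bar>exp t - c j\<bar> < \<epsilon>}" "a \<le> t \<and> t \<le> b"
    then have "exp a \<le> exp t" "exp t \<le> exp b" by auto
    with ab(1,2) show "t \<in> {t. \<bar>exp t - c j\<bar> < \<epsilon>}" unfolding mem_Collect_eq by linarith
  qed
  then have "convex ((\<lambda>x :: real ^ 'n. x $ j) -` {t. \<bar>exp t - c j\<bar> < \<epsilon>})" for j
    by (intro convex_linear_vimage is_interval_convex bounded_linear.linear bounded_linear_vec_nth)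
  then have "convex (\<Inter>j. (\<lambda>x :: real ^ 'n. x $ j) -` {t. \<bar>exp t - c j\<bar> < \<epsilon>})"
    by (intro convex_INT)
  moreover have "(\<Inter>j. (\<lambda>x :: real ^ 'n. x $ j) -` {t. \<bar>exp t - c j\<bar> < \<epsilon>}) =
      {x. \<forall>j. \<bar>exp (x $ j) - c j\<bar> < \<epsilon>}" by auto
  ultimately show ?thesis by simp
qed

lemma mod_box_nonempty:
  assumes "0 < \<epsilon>"
  shows "\<bar>exp ((\<chi> j. ln (cmod (p $ j) + \<epsilon> / 2)) $ j) - cmod (p $ j)\<bar> < \<epsilon>"
proof -
  have "0 < cmod (p $ j) + \<epsilon> / 2" using assms by (simp add: add_nonneg_pos)
  then show ?thesis using assms by simp
qed

text \<open>A separation of the logarithmic image would separate \<open>D\<close>: a point goes to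
  \<open>Q A\<close> or \<open>Q B\<close> according to the side that contains a small box around
  its moduli. Boxes are convex, so each lies on one side, and boxes around the same point meet, so
  the side is unique, also at points with zero coordinates.\<close>

lemma connected_log_image:
  fixes D :: "(complex ^ 'n) set"
  assumes D: "reinhardt_domain D" and fr: "frontier D \<noteq> {}"
  shows "connected (log_image D)"
proof (rule connectedI)
  fix A B :: "(real ^ 'n) set"
  assume AB: "open A" "open B" "A \<inter> log_image D \<noteq> {}" "B \<inter> log_image D \<noteq> {}"
    "A \<inter> B \<inter> log_image D = {}" "log_image D \<subseteq> A \<union> B"
  have oD: "open D" and cD: "connected D" using D by (auto simp: reinhardt_domain_def is_domain_def)
  define box where "box p \<epsilon> = {x :: real ^ 'n. \<forall>j. \<bar>exp (x $ j) - cmod (p $ j)\<bar> < \<epsilon>}"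
    for p :: "complex ^ 'n" and \<epsilon>
  have ex: "\<exists>\<epsilon>>0. box p \<epsilon> \<subseteq> log_image D" if "p \<in> D" for p
    using mod_box_subset_log_image[OF D that dist_bdry_pos[OF oD fr that]] by (auto simp: box_def)
  have mono: "box q (\<epsilon> / 2) \<subseteq> box p \<epsilon>" if "dist q p < \<epsilon> / 2" for p q \<epsilon>
  proof
    fix x assume x: "x \<in> box q (\<epsilon> / 2)"
    have "\<bar>exp (x $ j) - cmod (p $ j)\<bar> < \<epsilon>" for j
    proof -
      have "\<bar>cmod (q $ j) - cmod (p $ j)\<bar> \<le> cmod ((q - p) $ j)"
        using norm_triangle_ineq3 by simp
      also have "\<dots> \<le> dist q p" unfolding dist_norm by (rule Finite_Cartesian_Product.norm_nth_le)
      finally have "\<bar>cmod (q $ j) - cmod (p $ j)\<bar> < \<epsilon> / 2" using that by simp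
      moreover have "\<bar>exp (x $ j) - cmod (q $ j)\<bar> < \<epsilon> / 2" using x by (simp add: box_def)
      ultimately show ?thesis by arith
    qed
    then show "x \<in> box p \<epsilon>" by (simp add: box_def)
  qed
  have ne: "\<exists>x. x \<in> box p \<epsilon>" if "0 < \<epsilon>" for p \<epsilon>
    using mod_box_nonempty[OF that] unfolding box_def by blast
  define Q where "Q S = {p. \<exists>\<epsilon>>0. box p \<epsilon> \<subseteq> log_image D \<inter> S}" for S
  have openQ: "open (Q S)" for S
    unfolding open_dist
  proof
    fix p assume "p \<in> Q S"
    then obtain \<epsilon> where \<epsilon>: "\<epsilon> > 0" "box p \<epsilon> \<subseteq> log_image D \<inter> S" by (auto simp: Q_def)
    have "q \<in> Q S" if "dist q p < \<epsilon> / 2" for q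
      using mono[OF that] \<epsilon> half_gt_zero[OF \<epsilon>(1)] unfolding Q_def by blast
    then show "\<exists>e>0. \<forall>y. dist y p < e \<longrightarrow> y \<in> Q S" using half_gt_zero[OF \<epsilon>(1)] by blast
  qed
  have cover: "box p \<epsilon> \<subseteq> A \<or> box p \<epsilon> \<subseteq> B" if "box p \<epsilon> \<subseteq> log_image D" for p \<epsilon>
  proof -
    have "connected (box p \<epsilon>)" unfolding box_def by (intro convex_connected convex_mod_box)
    then show ?thesis
      using connectedD[of "box p \<epsilon>" A B] AB that by blast
  qed
  have cov: "D \<subseteq> Q A \<union> Q B"
  proof
    fix p assume "p \<in> D"
    then obtain \<epsilon> where "\<epsilon> > 0" "box p \<epsilon> \<subseteq> log_image D" using ex by blast
    then show "p \<in> Q A \<union> Q B" using cover[of p \<epsilon>] by (auto simp: Q_def)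
  qed
  have disj: "Q A \<inter> Q B \<inter> D = {}"
  proof -
    have False if pA: "p \<in> Q A" and pB: "p \<in> Q B" for p
    proof -
      obtain \<epsilon>1 where \<epsilon>1: "\<epsilon>1 > 0" "box p \<epsilon>1 \<subseteq> log_image D \<inter> A"
        using pA unfolding Q_def by blast
      obtain \<epsilon>2 where \<epsilon>2: "\<epsilon>2 > 0" "box p \<epsilon>2 \<subseteq> log_image D \<inter> B"
        using pB unfolding Q_def by blast
      note \<epsilon> = \<epsilon>1 \<epsilon>2
      obtain x where "x \<in> box p (min \<epsilon>1 \<epsilon>2)" using ne[of "min \<epsilon>1 \<epsilon>2" p] \<epsilon> by auto
      then have "x \<in> box p \<epsilon>1" "x \<in> box p \<epsilon>2" by (auto simp: box_def)
      then show False using \<epsilon> AB(5) by blast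
    qed
    then show ?thesis by blast
  qed
  have inter: "Q S \<inter> D \<noteq> {}" if S: "S \<inter> log_image D \<noteq> {}" "S = A \<or> S = B" for S
  proof -
    obtain x where x: "x \<in> S" "x \<in> log_image D" using S by blast
    then have xD: "exp_vec x \<in> D" by (simp add: log_image_def)
    then obtain \<epsilon> where \<epsilon>: "\<epsilon> > 0" "box (exp_vec x) \<epsilon> \<subseteq> log_image D" using ex by blast
    have "x \<in> box (exp_vec x) \<epsilon>" using \<epsilon>(1) by (simp add: box_def exp_vec_def)
    then have "box (exp_vec x) \<epsilon> \<subseteq> S" using cover[OF \<epsilon>(2)] S(2) x AB(5) by blast
    then show ?thesis using \<epsilon> xD by (auto simp: Q_def)
  qed
  show False
    using connectedD[OF cD openQ openQ disj cov] inter[OF AB(3)] inter[OF AB(4)] by simp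
qed

lemma log_image_limit:
  assumes D: "open D" and \<delta>: "0 < \<delta>"
    and u: "\<And>k :: nat. u k \<in> log_image D" "\<And>k. \<delta> \<le> dist_bdry D (exp_vec (u k))" and lim: "u \<longlonglongrightarrow> p"
  shows "p \<in> log_image D"
proof -
  have lim': "(\<lambda>k. exp_vec (u k)) \<longlonglongrightarrow> exp_vec p"
    by (rule continuous_on_tendsto_compose[OF continuous_on_exp_vec[of UNIV] lim]) auto
  have "exp_vec p \<in> closure D"
    using lim' u(1) unfolding closure_sequential log_image_def
    by (intro exI[of _ "\<lambda>k. exp_vec (u k)"]) auto
  moreover have "\<delta> \<le> dist_bdry D (exp_vec p)"
    using u(2) by (intro LIMSEQ_le_const[OF tendsto_infdist[OF lim']]) auto
  then have "exp_vec p \<notin> frontier D" using \<delta> by auto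
  ultimately show ?thesis using D by (simp add: frontier_def interior_open log_image_def)
qed

text \<open>The set \<open>T\<close> of points visible from \<open>x\<close> is open by compactness
  of segments. It is closed in the logarithmic image because quasiconcavity bounds the boundary
  distance from below, uniformly on the segments to a convergent sequence, so that limits stay off
  the boundary. Connectedness makes \<open>T\<close> everything.\<close>

lemma convex_log_image:
  fixes D :: "(complex ^ 'n) set"
  assumes D: "reinhardt_domain D" and pc: "pseudoconvex D" and fr: "frontier D \<noteq> {}"
  shows "convex (log_image D)"
proof -
  have oD: "open D" using D by (simp add: reinhardt_domain_def is_domain_def)
  have "\<forall>y\<in>log_image D. closed_segment x y \<subseteq> log_image D" if x: "x \<in> log_image D" for x
  proof -
    define T where "T = {y \<in> log_image D. closed_segment x y \<subseteq> log_image D}"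
    have op: "open T"
      unfolding open_dist
    proof
      fix y assume "y \<in> T"
      then have y: "y \<in> log_image D" "closed_segment x y \<subseteq> log_image D" by (auto simp: T_def)
      obtain e where e: "0 < e" "(\<Union>u\<in>closed_segment x y. ball u e) \<subseteq> log_image D"
        using compact_subset_open_imp_ball_epsilon_subset[OF compact_segment open_log_image[OF oD] y(2)]
        by metis
      have "z \<in> T" if z: "dist z y < e" for z
      proof -
        have "closed_segment x z \<subseteq> log_image D"
        proof
          fix w assume "w \<in> closed_segment x z"
          then obtain t where t: "0 \<le> t" "t \<le> 1" "w = (1 - t) *\<^sub>R x + t *\<^sub>R z"
            by (auto simp: closed_segment_def)
          define w' where "w' = (1 - t) *\<^sub>R x + t *\<^sub>R y"
          have "w' \<in> closed_segment x y" using t by (auto simp: closed_segment_def w'_def)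
          moreover have "w - w' = t *\<^sub>R (z - y)" by (simp add: t(3) w'_def algebra_simps)
          then have "dist w' w \<le> dist z y"
            using t by (simp add: dist_norm norm_minus_commute[of w'] mult_left_le_one_le)
          ultimately show "w \<in> log_image D" using e(2) z by force
        qed
        then show ?thesis by (auto simp: T_def)
      qed
      then show "\<exists>e>0. \<forall>z. dist z y < e \<longrightarrow> z \<in> T" using e(1) by blast
    qed
    have "\<exists>F. closed F \<and> T = log_image D \<inter> F"
    proof (intro exI conjI)
      show "T = log_image D \<inter> closure T"
      proof (intro equalityI subsetI)
        fix y assume "y \<in> log_image D \<inter> closure T"
        then have y: "y \<in> log_image D" "y \<in> closure T" by auto
        then obtain f where f: "\<And>k. f k \<in> T" "f \<longlonglongrightarrow> y" unfolding closure_sequential by blast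
        define d where "d z = dist_bdry D (exp_vec z)" for z
        have dpos: "0 < d z" if "z \<in> log_image D" for z
          using dist_bdry_pos[OF oD fr] that by (simp add: d_def log_image_def)
        have "(\<lambda>k. d (f k)) \<longlonglongrightarrow> d y"
          unfolding d_def
          by (intro tendsto_infdist continuous_on_tendsto_compose[OF continuous_on_exp_vec[of UNIV] f(2)]) auto
        then have "\<forall>\<^sub>F k in sequentially. d y / 2 < d (f k)"
          using dpos[OF y(1)] by (intro order_tendstoD) auto
        then obtain k0 where k0: "\<And>k. k \<ge> k0 \<Longrightarrow> d y / 2 < d (f k)"
          by (auto simp: eventually_sequentially)
        have "closed_segment x y \<subseteq> log_image D"
        proof
          fix w assume "w \<in> closed_segment x y"
          then obtain t where t: "0 \<le> t" "t \<le> 1" "w = (1 - t) *\<^sub>R x + t *\<^sub>R y"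
            by (auto simp: closed_segment_def)
          define u where "u k = (1 - t) *\<^sub>R x + t *\<^sub>R f (k + k0)" for k
          have useg: "u k \<in> closed_segment x (f (k + k0))" for k
            using t by (auto simp: closed_segment_def u_def)
          have fseg: "closed_segment x (f k) \<subseteq> log_image D" for k using f(1)[of k] by (simp add: T_def)
          show "w \<in> log_image D"
          proof (rule log_image_limit[OF oD])
            show "0 < min (d x) (d y / 2)" using dpos x y by auto
            show "u k \<in> log_image D" for k using useg fseg by blast
            show "min (d x) (d y / 2) \<le> dist_bdry D (exp_vec (u k))" for k
              using dist_bdry_segment_ge[OF D pc fr fseg useg[of k]] k0[of "k + k0"] unfolding d_def by auto
            show "u \<longlonglongrightarrow> w"
              unfolding u_def t(3) by (intro tendsto_intros LIMSEQ_ignore_initial_segment f(2))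
          qed
        qed
        then show "y \<in> T" using y by (simp add: T_def)
      next
        fix y assume y: "y \<in> T"
        then have "y \<in> log_image D" by (simp add: T_def)
        with y show "y \<in> log_image D \<inter> closure T" using closure_subset by blast
      qed
    qed simp
    moreover have "openin (top_of_set (log_image D)) T"
      using op by (auto simp: openin_open T_def intro!: exI[of _ T])
    moreover have "T \<noteq> {}" using x by (auto simp: T_def)
    ultimately have "T = log_image D"
      using connected_clopen[THEN iffD1, OF connected_log_image[OF D fr]] by (auto simp: closedin_closed)
    then show ?thesis by (auto simp: T_def)
  qed
  then show ?thesis by (simp add: convex_contains_segment)
qed

text \<open>If \<open>\<zeta> $ j = 0\<close>, the logarithmic image contains near \<open>w\<close> rays on which the \<open>j\<close>-th coordinate tends
  to \<open>-\<infinity>\<close> and the boundary distance stays bounded below. By quasiconcavity of the boundary distance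
  the same then holds from every point, so no point of \<open>D\<close> has the moduli of \<open>\<zeta>\<close> in the nonzero
  coordinates of \<open>\<zeta>\<close>: otherwise \<open>\<zeta>\<close> itself would have positive boundary distance.\<close>

lemma log_image_support:
  fixes D :: "(complex ^ 'n) set"
  assumes D: "reinhardt_domain D" and pc: "pseudoconvex D" and \<zeta>: "\<zeta> \<in> frontier D"
    and w: "w \<in> D" "\<And>j. \<zeta> $ j = 0 \<Longrightarrow> w $ j = 0"
  obtains a :: "real ^ 'n" where "a \<noteq> 0" "\<And>j. \<zeta> $ j = 0 \<Longrightarrow> a $ j = 0"
    "\<And>x. x \<in> log_image D \<Longrightarrow> (\<Sum>j\<in>UNIV. a $ j * x $ j) < (\<Sum>j\<in>UNIV. a $ j * ln (cmod (\<zeta> $ j)))"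
proof -
  have oD: "open D" using D by (simp add: reinhardt_domain_def is_domain_def)
  have fr: "frontier D \<noteq> {}" using \<zeta> by auto
  define J where "J = {j. \<zeta> $ j \<noteq> 0}"
  define y where "y = (\<chi> j. ln (cmod (\<zeta> $ j)))"
  \<comment> \<open>The cylinder over the projection of the logarithmic image to the coordinates in
    \<open>J\<close>; a linear functional bounded below on it has no components outside
    \<open>J\<close>.\<close>
  define \<Omega> where "\<Omega> = {x :: real ^ 'n. \<exists>x'\<in>log_image D. \<forall>j\<in>J. x $ j = x' $ j}"
  have L\<Omega>: "log_image D \<subseteq> \<Omega>" by (auto simp: \<Omega>_def)
  obtain \<epsilon> where \<epsilon>: "\<epsilon> > 0" "\<And>x. (\<And>j. \<bar>exp (x $ j) - cmod (w $ j)\<bar> < \<epsilon>) \<Longrightarrow>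
      x \<in> log_image D \<and> dist_bdry D w / 2 \<le> dist_bdry D (exp_vec x)"
    using mod_box_subset_log_image[OF D w(1), of "dist_bdry D w / 2"] dist_bdry_pos[OF oD fr w(1)] by auto
  define x' where "x' = (\<chi> j. ln (cmod (w $ j) + \<epsilon> / 2))"
  have x': "x' + t \<in> log_image D \<and> dist_bdry D w / 2 \<le> dist_bdry D (exp_vec (x' + t))"
    if t: "\<And>j. j \<in> J \<Longrightarrow> t $ j = 0" "\<And>j. t $ j \<le> 0" for t
  proof (rule \<epsilon>(2))
    fix j
    show "\<bar>exp ((x' + t) $ j) - cmod (w $ j)\<bar> < \<epsilon>"
    proof (cases "j \<in> J")
      case True
      then show ?thesis using mod_box_nonempty[OF \<epsilon>(1), of w j] t(1) by (simp add: x'_def)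
    next
      case False
      then have wj: "w $ j = 0" using w(2) by (simp add: J_def)
      have "exp ((x' + t) $ j) \<le> exp (x' $ j)" using t(2) by simp
      also have "\<dots> = \<epsilon> / 2" using wj \<epsilon>(1) by (simp add: x'_def)
      also have "\<dots> < \<epsilon>" using \<epsilon>(1) by simp
      finally show ?thesis using wj by simp
    qed
  qed
  have y: "y \<notin> \<Omega>"
  proof
    assume "y \<in> \<Omega>"
    then obtain x where x: "x \<in> log_image D" "\<And>j. j \<in> J \<Longrightarrow> x $ j = ln (cmod (\<zeta> $ j))"
      by (auto simp: \<Omega>_def y_def)
    define \<delta> where "\<delta> = min (dist_bdry D (exp_vec x)) (dist_bdry D w / 2)"
    have \<delta>: "0 < \<delta>"
      using dist_bdry_pos[OF oD fr] w(1) x(1) by (simp add: \<delta>_def log_image_def)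
    \<comment> \<open>The square beats the weight \<open>1 / k\<close> of the convex combination:
      outside \<open>J\<close> the coordinates of \<open>u k\<close> behave like \<open>- k\<close>,
      so the moduli tend to 0, while those in \<open>J\<close> tend to the coordinates of
      \<open>x\<close>.\<close>
    define t where "t k = (\<chi> j. if j \<in> J then 0 else - (real k)\<^sup>2)" for k :: nat
    define u where "u k = (1 - 1 / real k) *\<^sub>R x + (1 / real k) *\<^sub>R (x' + t k)" for k
    have uj: "u k $ j = (1 - 1 / real k) * x $ j + (1 / real k) * x' $ j" if "j \<in> J" for k j
      using that by (simp add: u_def t_def)
    have uj': "u k $ j = (1 - 1 / real k) * x $ j + (1 / real k) * x' $ j - real k" if "j \<notin> J" "k > 0" for k j
      using that by (simp add: u_def t_def field_simps power2_eq_square)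
    have \<delta>le: "\<delta> \<le> dist_bdry D (exp_vec (u k))" if "k > 0" for k
    proof -
      have xt: "x' + t k \<in> log_image D" "dist_bdry D w / 2 \<le> dist_bdry D (exp_vec (x' + t k))"
        using x'[of "t k"] by (auto simp: t_def)
      have "closed_segment x (x' + t k) \<subseteq> log_image D"
        using convex_log_image[OF D pc fr] x(1) xt(1) by (rule closed_segment_subset[rotated 2])
      moreover have "u k \<in> closed_segment x (x' + t k)"
        using that by (auto simp: closed_segment_def u_def intro!: exI[of _ "1 / real k"])
      ultimately show ?thesis
        using dist_bdry_segment_ge[OF D pc fr] xt(2) unfolding \<delta>_def by fastforce
    qed
    define Z :: "complex ^ 'n" where "Z = (\<chi> j. of_real (cmod (\<zeta> $ j)))"
    have inv: "(\<lambda>k. 1 / real k) \<longlonglongrightarrow> 0" by (rule lim_1_over_n)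
    have "(\<lambda>k. exp_vec (u k)) \<longlonglongrightarrow> Z"
    proof (rule vec_tendstoI)
      fix j
      have lim: "(\<lambda>k. (1 - 1 / real k) * x $ j + (1 / real k) * x' $ j) \<longlonglongrightarrow> x $ j"
        using inv by (auto intro!: tendsto_eq_intros)
      show "(\<lambda>k. exp_vec (u k) $ j) \<longlonglongrightarrow> Z $ j"
      proof (cases "j \<in> J")
        case True
        have "(\<lambda>k. of_real (exp (u k $ j))) \<longlonglongrightarrow> (of_real (exp (x $ j)) :: complex)"
          unfolding uj[OF True] by (intro tendsto_intros lim)
        then show ?thesis using x(2)[OF True] True by (simp add: exp_vec_def Z_def J_def)
      next
        case False
        have "(\<lambda>k. exp (- real k)) \<longlonglongrightarrow> 0"
          by (rule filterlim_compose[OF exp_at_bot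
                filterlim_compose[OF filterlim_uminus_at_bot_at_top filterlim_real_sequentially]])
        then have "(\<lambda>k. exp ((1 - 1 / real k) * x $ j + (1 / real k) * x' $ j) * exp (- real k)) \<longlonglongrightarrow> exp (x $ j) * 0"
          by (intro tendsto_mult tendsto_exp lim)
        moreover have "\<forall>\<^sub>F k in sequentially.
            exp ((1 - 1 / real k) * x $ j + (1 / real k) * x' $ j) * exp (- real k) = exp (u k $ j)"
          using eventually_gt_at_top[of 0] by eventually_elim (simp add: uj'[OF False] flip: exp_add)
        ultimately have "(\<lambda>k. exp (u k $ j)) \<longlonglongrightarrow> exp (x $ j) * 0"
          by (rule Lim_transform_eventually)
        then have "(\<lambda>k. exp (u k $ j)) \<longlonglongrightarrow> 0" by simp
        then have "(\<lambda>k. of_real (exp (u k $ j))) \<longlonglongrightarrow> (of_real 0 :: complex)"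
          by (rule tendsto_of_real)
        then show ?thesis using False by (simp add: exp_vec_def Z_def J_def)
      qed
    qed
    then have "(\<lambda>k. dist_bdry D (exp_vec (u k))) \<longlonglongrightarrow> dist_bdry D Z" by (rule tendsto_infdist)
    then have "\<delta> \<le> dist_bdry D Z"
      using \<delta>le by (intro LIMSEQ_le_const[of _ _ \<delta>]) (auto intro!: exI[of _ 1])
    also have "dist_bdry D Z = dist_bdry D \<zeta>"
      by (rule reinhardt_same_modulus(2)[OF D]) (simp add: Z_def)
    also have "\<dots> = 0" using \<zeta> by simp
    finally show False using \<delta> by simp
  qed
  have conv: "convex \<Omega>"
    unfolding convex_def
  proof (intro ballI allI impI)
    fix p q and r s :: real assume "p \<in> \<Omega>" "q \<in> \<Omega>" and rs: "0 \<le> r" "0 \<le> s" "r + s = 1"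
    then obtain p' q' where "p' \<in> log_image D" "q' \<in> log_image D"
        "\<And>j. j \<in> J \<Longrightarrow> p $ j = p' $ j" "\<And>j. j \<in> J \<Longrightarrow> q $ j = q' $ j"
      unfolding \<Omega>_def by blast
    then show "r *\<^sub>R p + s *\<^sub>R q \<in> \<Omega>"
      using convexD[OF convex_log_image[OF D pc fr] _ _ rs]
      by (auto simp: \<Omega>_def intro!: bexI[of _ "r *\<^sub>R p' + s *\<^sub>R q'"])
  qed
  obtain x0 where x0: "x0 \<in> log_image D" using x'[of 0] by auto
  obtain a \<beta> where a: "a \<noteq> 0" "\<And>x. x \<in> {y} \<Longrightarrow> a \<bullet> x \<le> \<beta>" "\<And>x. x \<in> \<Omega> \<Longrightarrow> \<beta> \<le> a \<bullet> x"
  proof -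
    have "\<Omega> \<noteq> {}" "{y} \<inter> \<Omega> = {}" using L\<Omega> x0 y by auto
    then show ?thesis
      using separating_hyperplane_sets[OF convex_singleton conv, of y] that by blast
  qed
  have le: "a \<bullet> y \<le> a \<bullet> x" if "x \<in> \<Omega>" for x using a(2)[of y] a(3)[OF that] by simp
  have aJ: "a $ j = 0" if j: "j \<notin> J" for j
  proof (rule ccontr)
    assume aj: "a $ j \<noteq> 0"
    define t where "t = (a \<bullet> y - a \<bullet> x0 - 1) / a $ j"
    have "x0 + axis j t \<in> \<Omega>" using x0 j by (auto simp: \<Omega>_def axis_def intro!: bexI[of _ x0])
    from le[OF this] have "a \<bullet> y \<le> a \<bullet> x0 + a $ j * t"
      by (simp add: inner_add_right inner_axis)
    then show False using aj by (simp add: t_def)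
  qed
  \<comment> \<open>Equality is impossible, since the open logarithmic image would contain a point
    moved slightly against \<open>a\<close>.\<close>
  have lt: "a \<bullet> y < a \<bullet> x" if x: "x \<in> log_image D" for x
  proof (rule ccontr)
    assume "\<not> a \<bullet> y < a \<bullet> x"
    obtain e where e: "0 < e" "ball x e \<subseteq> log_image D"
      using open_log_image[OF oD] x open_contains_ball by blast
    define h where "h = (e / (2 * norm a)) *\<^sub>R a"
    have "norm h < e" using e(1) a(1) by (simp add: h_def)
    then have "x - h \<in> ball x e" by (simp add: dist_norm)
    then have "a \<bullet> y \<le> a \<bullet> (x - h)" using e(2) L\<Omega> le by blast
    moreover have "0 < a \<bullet> h" using e(1) a(1) by (simp add: h_def)
    ultimately show False using \<open>\<not> a \<bullet> y < a \<bullet> x\<close> by (simp add: inner_diff_right)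
  qed
  show thesis
  proof (rule that[of "- a"])
    show "- a \<noteq> 0" using a(1) by simp
    show "(- a) $ j = 0" if "\<zeta> $ j = 0" for j using aJ[of j] that by (simp add: J_def)
    show "(\<Sum>j\<in>UNIV. (- a) $ j * x $ j) < (\<Sum>j\<in>UNIV. (- a) $ j * ln (cmod (\<zeta> $ j)))"
      if "x \<in> log_image D" for x
      using lt[OF that] by (simp add: inner_vec_def y_def sum_negf)
  qed
qed

section \<open>The boundary estimate\<close>

text \<open>The hypothesis bounds the increment over each link of a chain by the Lempert function,
  and the increments telescope.\<close>

lemma kobayashi_ge:
  assumes "\<And>f l m. f \<in> holomorphic_discs D \<Longrightarrow> l \<in> ball 0 1 \<Longrightarrow> m \<in> ball 0 1 \<Longrightarrow>
      \<Theta> (f m) - \<Theta> (f l) \<le> poincare_dist l m"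
  shows "ereal (\<Theta> z - \<Theta> w) \<le> kobayashi D w z"
  unfolding kobayashi_def
proof (rule Inf_greatest, clarify)
  fix N and c :: "nat \<Rightarrow> complex ^ 'a"
  have L: "ereal (\<Theta> z - \<Theta> w) \<le> lempert D w z" for w z
    unfolding lempert_def using assms by (intro Inf_greatest) auto
  have "ereal (\<Theta> (c N) - \<Theta> (c 0)) = (\<Sum>j<N. ereal (\<Theta> (c (Suc j)) - \<Theta> (c j)))"
    using sum_lessThan_telescope[of "\<lambda>j. \<Theta> (c j)" N] by simp
  also have "\<dots> \<le> (\<Sum>j<N. lempert D (c j) (c (Suc j)))"
    by (intro sum_mono L)
  finally show "ereal (\<Theta> (c N) - \<Theta> (c 0)) \<le> (\<Sum>j<N. lempert D (c j) (c (Suc j)))" .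
qed

section \<open>The weighted modulus as a peak function\<close>

text \<open>Indices of exponent 0 are left out because \<open>0 powr 0 = 0\<close> would annihilate
  the product at vanishing coordinates. In logarithmic coordinates this is the exponential of an
  affine function.\<close>

definition weighted_modulus :: "real ^ 'n \<Rightarrow> complex ^ 'n \<Rightarrow> complex ^ 'n \<Rightarrow> real" where
  "weighted_modulus a \<zeta> z = (\<Prod>j\<in>{j. a $ j \<noteq> 0}. cmod (z $ j / \<zeta> $ j) powr a $ j)"

lemma weighted_modulus_eq_exp:
  assumes "\<And>j. a $ j \<noteq> 0 \<Longrightarrow> z $ j \<noteq> 0 \<and> \<zeta> $ j \<noteq> 0"
  shows "weighted_modulus a \<zeta> z = exp (\<Sum>j\<in>UNIV. a $ j * (ln (cmod (z $ j)) - ln (cmod (\<zeta> $ j))))"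
proof -
  have "weighted_modulus a \<zeta> z =
      exp (\<Sum>j\<in>{j. a $ j \<noteq> 0}. a $ j * (ln (cmod (z $ j)) - ln (cmod (\<zeta> $ j))))"
    using assms by (auto simp: weighted_modulus_def exp_sum powr_def norm_divide ln_div intro!: prod.cong)
  also have "(\<Sum>j\<in>{j. a $ j \<noteq> 0}. a $ j * (ln (cmod (z $ j)) - ln (cmod (\<zeta> $ j)))) =
      (\<Sum>j\<in>UNIV. a $ j * (ln (cmod (z $ j)) - ln (cmod (\<zeta> $ j))))"
    by (intro sum.mono_neutral_left) auto
  finally show ?thesis .
qed

text \<open>The exponents come from the supporting hyperplane. If \<open>a $ k < 0\<close> and a
  point of \<open>D\<close> had \<open>z $ k = 0\<close>, sending the \<open>k\<close>-th
  logarithmic coordinate to \<open>- \<infinity>\<close> would make the bounded functional tend to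
  \<open>\<infinity>\<close>. Division by the least positive exponent raises the modulus to a
  positive power, which keeps it below 1.\<close>

lemma reinhardt_peak_weights:
  fixes D :: "(complex ^ 'n) set"
  assumes D: "reinhardt_domain D" and pc: "pseudoconvex D" and \<zeta>: "\<zeta> \<in> frontier D"
    and w: "w \<in> D" "\<And>j. \<zeta> $ j = 0 \<Longrightarrow> w $ j = 0"
  obtains a :: "real ^ 'n" where "\<And>j. \<zeta> $ j = 0 \<Longrightarrow> a $ j = 0"
    "\<And>j. 1 \<le> a $ j \<or> a $ j = 0 \<or> (\<forall>z\<in>D. z $ j \<noteq> 0)"
    "\<And>z. z \<in> D \<Longrightarrow> weighted_modulus a \<zeta> z < 1"
proof -
  have oD: "open D" using D by (simp add: reinhardt_domain_def is_domain_def)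
  have fr: "frontier D \<noteq> {}" using \<zeta> by auto
  obtain a :: "real ^ 'n" where a: "\<And>j. \<zeta> $ j = 0 \<Longrightarrow> a $ j = 0"
    and lt: "\<And>x. x \<in> log_image D \<Longrightarrow> (\<Sum>j\<in>UNIV. a $ j * x $ j) < (\<Sum>j\<in>UNIV. a $ j * ln (cmod (\<zeta> $ j)))"
    using log_image_support[OF D pc \<zeta> w] by metis
  have box: "\<exists>\<epsilon>>0. \<forall>x. (\<forall>j. \<bar>exp (x $ j) - cmod (z $ j)\<bar> < \<epsilon>) \<longrightarrow> x \<in> log_image D" if "z \<in> D" for z
    using mod_box_subset_log_image[OF D that dist_bdry_pos[OF oD fr that]] by blast
  have neg: "z $ k \<noteq> 0" if z: "z \<in> D" and k: "a $ k < 0" for z k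
  proof
    assume zk: "z $ k = 0"
    obtain \<epsilon> where \<epsilon>: "\<epsilon> > 0" "\<And>x. (\<And>j. \<bar>exp (x $ j) - cmod (z $ j)\<bar> < \<epsilon>) \<Longrightarrow> x \<in> log_image D"
      using box[OF z] by blast
    define x where "x t = (\<chi> j. if j = k then t else ln (cmod (z $ j) + \<epsilon> / 2))" for t
    have xin: "x t \<in> log_image D" if t: "t < ln \<epsilon>" for t
    proof (rule \<epsilon>(2))
      fix j
      show "\<bar>exp (x t $ j) - cmod (z $ j)\<bar> < \<epsilon>"
      proof (cases "j = k")
        case True
        have "exp t < exp (ln \<epsilon>)" using t by simp
        then show ?thesis using True zk \<epsilon>(1) by (simp add: x_def)
      next
        case False
        then show ?thesis using mod_box_nonempty[OF \<epsilon>(1), of z j] by (simp add: x_def)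
      qed
    qed
    define R where "R = (\<Sum>j\<in>UNIV - {k}. a $ j * ln (cmod (z $ j) + \<epsilon> / 2))"
    define B where "B = (\<Sum>j\<in>UNIV. a $ j * ln (cmod (\<zeta> $ j)))"
    have sum: "(\<Sum>j\<in>UNIV. a $ j * x t $ j) = a $ k * t + R" for t
      unfolding R_def by (subst sum.remove[of _ k]) (auto simp: x_def intro!: sum.cong)
    \<comment> \<open>Below \<open>ln \<epsilon>\<close> to stay in the logarithmic image, and so
      far down that \<open>a $ k * t + R\<close> reaches the bound \<open>B\<close>.\<close>
    define t where "t = min (ln \<epsilon> - 1) ((B - R) / a $ k)"
    have "t < ln \<epsilon>" by (simp add: t_def)
    then have "a $ k * t + R < B" using lt[OF xin] sum by (simp add: B_def)
    moreover have "t \<le> (B - R) / a $ k" by (simp add: t_def)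
    then have "B - R \<le> a $ k * t" using k by (simp add: neg_le_divide_eq mult.commute)
    ultimately show False by simp
  qed
  have wlt: "weighted_modulus a \<zeta> z < 1" if z: "z \<in> D" for z
  proof (cases "\<exists>j. a $ j \<noteq> 0 \<and> z $ j = 0")
    case True
    then have "weighted_modulus a \<zeta> z = 0" unfolding weighted_modulus_def by (intro prod_zero) auto
    then show ?thesis by simp
  next
    case False
    obtain \<epsilon> where \<epsilon>: "\<epsilon> > 0" "\<And>x. (\<And>j. \<bar>exp (x $ j) - cmod (z $ j)\<bar> < \<epsilon>) \<Longrightarrow> x \<in> log_image D"
      using box[OF z] by blast
    \<comment> \<open>Coordinates with \<open>z $ j = 0\<close> have exponent 0 here; the modulus
      \<open>\<epsilon> / 2\<close> moves them into the logarithmic image without changing the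
      functional.\<close>
    define x where "x = (\<chi> j. if z $ j = 0 then ln (\<epsilon> / 2) else ln (cmod (z $ j)))"
    have "x \<in> log_image D"
      by (rule \<epsilon>(2)) (use \<epsilon>(1) in \<open>auto simp: x_def\<close>)
    then have "(\<Sum>j\<in>UNIV. a $ j * x $ j) < (\<Sum>j\<in>UNIV. a $ j * ln (cmod (\<zeta> $ j)))" by (rule lt)
    moreover have "(\<Sum>j\<in>UNIV. a $ j * x $ j) = (\<Sum>j\<in>UNIV. a $ j * ln (cmod (z $ j)))"
      using False by (intro sum.cong) (auto simp: x_def)
    ultimately have "(\<Sum>j\<in>UNIV. a $ j * (ln (cmod (z $ j)) - ln (cmod (\<zeta> $ j)))) < 0"
      by (simp add: right_diff_distrib sum_subtractf)
    moreover have "z $ j \<noteq> 0 \<and> \<zeta> $ j \<noteq> 0" if "a $ j \<noteq> 0" for j using that False a by blast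
    ultimately show ?thesis by (subst weighted_modulus_eq_exp) auto
  qed
  \<comment> \<open>The inserted 1 keeps the minimum positive and defined when no exponent is
    positive.\<close>
  define m where "m = Min (insert 1 {a $ j | j. 0 < a $ j})"
  have fin: "finite {a $ j | j. 0 < a $ j}" by simp
  have m: "0 < m" using fin by (auto simp: m_def)
  have mle: "m \<le> a $ j" if "0 < a $ j" for j
    unfolding m_def using that fin by (intro Min_le) auto
  define a' where "a' = (1 / m) *\<^sub>R a"
  show thesis
  proof (rule that[of a'])
    show "a' $ j = 0" if "\<zeta> $ j = 0" for j using a[OF that] by (simp add: a'_def)
    show "1 \<le> a' $ j \<or> a' $ j = 0 \<or> (\<forall>z\<in>D. z $ j \<noteq> 0)" for j
    proof -
      consider "0 < a $ j" | "a $ j = 0" | "a $ j < 0" by linarith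
      then show ?thesis
      proof cases
        case 1
        then show ?thesis using mle[OF 1] m by (simp add: a'_def pos_le_divide_eq)
      next
        case 3
        then show ?thesis using neg by blast
      qed (simp add: a'_def)
    qed
    show "weighted_modulus a' \<zeta> z < 1" if z: "z \<in> D" for z
    proof -
      have eq: "{j. a' $ j \<noteq> 0} = {j. a $ j \<noteq> 0}" using m by (simp add: a'_def)
      have "weighted_modulus a' \<zeta> z = (\<Prod>j\<in>{j. a $ j \<noteq> 0}. (cmod (z $ j / \<zeta> $ j) powr a $ j) powr (1 / m))"
        unfolding weighted_modulus_def eq by (simp add: a'_def powr_powr)
      also have "\<dots> = weighted_modulus a \<zeta> z powr (1 / m)"
        unfolding weighted_modulus_def by (subst prod_powr_distrib) auto
      also have "\<dots> < 1 powr (1 / m)"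
        using wlt[OF z] m by (intro powr_less_mono2) (auto simp: weighted_modulus_def intro!: prod_nonneg)
      finally show ?thesis by simp
    qed
  qed
qed

text \<open>By \<open>1 - exp u \<le> - u\<close> it remains to bound differences of logarithms.
  These are Lipschitz, since \<open>r\<close> keeps \<open>cmod (z $ j)\<close> above
  \<open>cmod (\<zeta> $ j) / 2\<close> wherever \<open>\<zeta> $ j \<noteq> 0\<close>.\<close>

lemma weighted_modulus_boundary_bound:
  fixes a :: "real ^ 'n" and \<zeta> :: "complex ^ 'n"
  assumes a: "\<And>j. \<zeta> $ j = 0 \<Longrightarrow> a $ j = 0"
  obtains C r where "0 < C" "0 < r"
    "\<And>z. dist z \<zeta> < r \<Longrightarrow> 1 - weighted_modulus a \<zeta> z \<le> C * dist z \<zeta>"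
proof -
  define J where "J = {j. \<zeta> $ j \<noteq> 0}"
  define r where "r = Min (insert 1 ((\<lambda>j. cmod (\<zeta> $ j) / 2) ` J))"
  have r: "0 < r" by (auto simp: r_def J_def)
  have rle: "r \<le> cmod (\<zeta> $ j) / 2" if "\<zeta> $ j \<noteq> 0" for j
    unfolding r_def using that by (intro Min_le) (auto simp: J_def)
  define C where "C = (\<Sum>j\<in>UNIV. \<bar>a $ j\<bar> * (2 / cmod (\<zeta> $ j))) + 1"
  have C: "0 < C" unfolding C_def by (intro add_nonneg_pos sum_nonneg) auto
  have "1 - weighted_modulus a \<zeta> z \<le> C * dist z \<zeta>" if z: "dist z \<zeta> < r" for z
  proof -
    have zj: "cmod (z $ j - \<zeta> $ j) \<le> dist z \<zeta>" for j
      using Finite_Cartesian_Product.norm_nth_le[of "z - \<zeta>" j] by (simp add: dist_norm)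
    have ln_le: "\<bar>ln t\<bar> \<le> 2 * \<bar>t - 1\<bar>" if "1 / 2 \<le> t" for t :: real
    proof (cases "1 \<le> t")
      case True
      then show ?thesis using ln_le_minus_one[of t] by simp
    next
      case False
      have "- ln t = ln (1 / t)" using that by (simp add: ln_div)
      also have "\<dots> \<le> 1 / t - 1" using that by (intro ln_le_minus_one) auto
      also have "\<dots> = (1 - t) / t" using that by (simp add: field_simps)
      also have "\<dots> \<le> (1 - t) / (1 / 2)" using that False by (intro divide_left_mono) auto
      finally show ?thesis using False that by simp
    qed
    have summand: "- (a $ j * (ln (cmod (z $ j)) - ln (cmod (\<zeta> $ j)))) \<le> \<bar>a $ j\<bar> * (2 / cmod (\<zeta> $ j)) * dist z \<zeta>"
      and nz: "a $ j \<noteq> 0 \<Longrightarrow> z $ j \<noteq> 0 \<and> \<zeta> $ j \<noteq> 0" for j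
    proof -
      have *: "z $ j \<noteq> 0 \<and> \<bar>ln (cmod (z $ j)) - ln (cmod (\<zeta> $ j))\<bar> \<le> 2 / cmod (\<zeta> $ j) * dist z \<zeta>"
        if j: "\<zeta> $ j \<noteq> 0"
      proof -
        have c: "0 < cmod (\<zeta> $ j)" using j by simp
        have d: "\<bar>cmod (z $ j) - cmod (\<zeta> $ j)\<bar> \<le> dist z \<zeta>"
          using norm_triangle_ineq3[of "z $ j" "\<zeta> $ j"] zj[of j] by linarith
        then have half: "cmod (\<zeta> $ j) / 2 < cmod (z $ j)" using z rle[OF j] c by linarith
        then have t: "1 / 2 \<le> cmod (z $ j) / cmod (\<zeta> $ j)" using c by (simp add: field_simps)
        have zn: "z $ j \<noteq> 0" using half c by auto
        have "\<bar>ln (cmod (z $ j)) - ln (cmod (\<zeta> $ j))\<bar> = \<bar>ln (cmod (z $ j) / cmod (\<zeta> $ j))\<bar>"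
          using zn j by (simp add: ln_div)
        also have "\<dots> \<le> 2 * \<bar>cmod (z $ j) / cmod (\<zeta> $ j) - 1\<bar>" by (rule ln_le[OF t])
        also have "cmod (z $ j) / cmod (\<zeta> $ j) - 1 = (cmod (z $ j) - cmod (\<zeta> $ j)) / cmod (\<zeta> $ j)"
          using c by (simp add: field_simps)
        also have "2 * \<bar>(cmod (z $ j) - cmod (\<zeta> $ j)) / cmod (\<zeta> $ j)\<bar> \<le> 2 * (dist z \<zeta> / cmod (\<zeta> $ j))"
          using d c by (simp add: divide_right_mono)
        finally show ?thesis using zn by simp
      qed
      show "a $ j \<noteq> 0 \<Longrightarrow> z $ j \<noteq> 0 \<and> \<zeta> $ j \<noteq> 0" using * a by blast
      show "- (a $ j * (ln (cmod (z $ j)) - ln (cmod (\<zeta> $ j)))) \<le> \<bar>a $ j\<bar> * (2 / cmod (\<zeta> $ j)) * dist z \<zeta>"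
      proof (cases "a $ j = 0")
        case False
        then have "\<bar>ln (cmod (z $ j)) - ln (cmod (\<zeta> $ j))\<bar> \<le> 2 / cmod (\<zeta> $ j) * dist z \<zeta>" using * a by blast
        then have "\<bar>a $ j * (ln (cmod (z $ j)) - ln (cmod (\<zeta> $ j)))\<bar> \<le> \<bar>a $ j\<bar> * (2 / cmod (\<zeta> $ j) * dist z \<zeta>)"
          unfolding abs_mult by (rule mult_left_mono) simp
        then show ?thesis by (simp add: mult.assoc)
      qed simp
    qed
    have "1 - weighted_modulus a \<zeta> z \<le> - (\<Sum>j\<in>UNIV. a $ j * (ln (cmod (z $ j)) - ln (cmod (\<zeta> $ j))))"
      using exp_ge_add_one_self by (subst weighted_modulus_eq_exp[OF nz]) (auto simp: algebra_simps)
    also have "\<dots> \<le> (\<Sum>j\<in>UNIV. \<bar>a $ j\<bar> * (2 / cmod (\<zeta> $ j)) * dist z \<zeta>)"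
      unfolding sum_negf[symmetric] by (intro sum_mono summand)
    also have "\<dots> = (C - 1) * dist z \<zeta>" by (simp add: C_def sum_distrib_right)
    also have "\<dots> \<le> C * dist z \<zeta>" by (simp add: mult_right_mono)
    finally show ?thesis .
  qed
  then show thesis using C r that by blast
qed

section \<open>Geometry of the cone at a smooth boundary point\<close>

text \<open>In the cone \<open>\<nu> \<bullet> (z - \<zeta>) \<le> - cos \<alpha> * dist z
  \<zeta>\<close>. On the ball around \<open>z\<close> of radius
  \<open>cos \<alpha> / 2 * dist z \<zeta>\<close> at least half of this remains, and near
  \<open>\<zeta>\<close> it dominates the remainder of the first-order expansion of
  \<open>\<rho>\<close>. So the ball lies in \<open>D\<close>, and its radius bounds the boundary
  distance from below.\<close>

lemma defining_fun_cone_estimate: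
  fixes D :: "(complex ^ 'n) set"
  assumes ldf: "local_defining_fun D \<zeta> U \<rho>" and oD: "open D" and \<zeta>: "\<zeta> \<in> frontier D"
    and \<alpha>: "0 < \<alpha>" "\<alpha> < pi / 2"
  obtains c r where "0 < c" "0 < r"
    "\<And>z. z \<in> cone_at \<zeta> (- unit_normal D \<zeta>) \<alpha> \<Longrightarrow> dist z \<zeta> < r \<Longrightarrow> z \<in> D \<and> c * dist z \<zeta> \<le> dist_bdry D z"
proof -
  define g where "g = grad_bar \<rho> \<zeta>"
  define \<nu> where "\<nu> = unit_normal D \<zeta>"
  have U: "open U" "\<zeta> \<in> U" "U \<inter> D = {z \<in> U. \<rho> z < 0}" and g0: "g \<noteq> 0"
    using ldf by (auto simp: local_defining_fun_def g_def)
  have \<nu>: "\<nu> = g /\<^sub>R norm g" unfolding \<nu>_def g_def by (rule unit_normal_eq[OF ldf oD \<zeta>])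
  have n\<nu>: "norm \<nu> = 1" using g0 by (simp add: \<nu>)
  have g\<nu>: "g \<bullet> h = norm g * (\<nu> \<bullet> h)" for h using g0 by (simp add: \<nu>)
  have diff: "\<rho> differentiable (at \<zeta>)"
    using ldf unfolding local_defining_fun_def C1_fun_on_def differentiable_def by blast
  have "(\<rho> has_derivative (\<lambda>h. 2 * (g \<bullet> h))) (at \<zeta>)"
    using diff[unfolded frechet_derivative_works] unfolding g_def
    by (rule has_derivative_eq_rhs) (simp add: fun_eq_iff frechet_derivative_grad_bar[OF diff])
  moreover define \<kappa> where "\<kappa> = cos \<alpha>"
  have \<kappa>: "0 < \<kappa>" "\<kappa> \<le> 1" unfolding \<kappa>_def using \<alpha> by (auto intro: cos_gt_zero)
  \<comment> \<open>Since \<open>norm (x - \<zeta>) < 2 * R\<close> below, the remainder is at most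
    \<open>norm g * \<kappa> * R / 2\<close>, half of what the linear part provides.\<close>
  define \<eta> where "\<eta> = norm g * \<kappa> / 4"
  have \<eta>: "0 < \<eta>" using \<kappa> g0 by (simp add: \<eta>_def)
  ultimately obtain r1 where r1: "0 < r1"
    "\<And>y. norm (y - \<zeta>) < r1 \<Longrightarrow> norm (\<rho> y - \<rho> \<zeta> - 2 * (g \<bullet> (y - \<zeta>))) \<le> \<eta> * norm (y - \<zeta>)"
    unfolding has_derivative_at_alt by blast
  obtain r2 where r2: "0 < r2" "ball \<zeta> r2 \<subseteq> U" using U open_contains_ball by blast
  have \<rho>0: "\<rho> \<zeta> = 0" by (rule local_defining_fun_zero[OF ldf oD \<zeta>])
  have main: "x \<in> D" if z: "z \<in> cone_at \<zeta> (- \<nu>) \<alpha>" "dist z \<zeta> < min r1 r2 / 2"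
    and x: "dist x z \<le> \<kappa> / 2 * dist z \<zeta>" for z x
  proof -
    define R where "R = dist z \<zeta>"
    have R: "0 < R" using z(1) by (simp add: R_def cone_at_def)
    define q where "q = (- \<nu> \<bullet> (z - \<zeta>)) / (norm (- \<nu>) * norm (z - \<zeta>))"
    have nz: "norm (z - \<zeta>) = R" by (simp add: R_def dist_norm)
    have q1: "\<bar>q\<bar> \<le> 1"
      using Cauchy_Schwarz_ineq2[of "- \<nu>" "z - \<zeta>"] R n\<nu> nz by (simp add: q_def abs_div)
    have "arccos q \<le> \<alpha>" using z(1) by (simp add: cone_at_def q_def)
    then have "cos \<alpha> \<le> cos (arccos q)"
      using q1 \<alpha> by (intro cos_monotone_0_pi_le) (auto intro: arccos_lbound)
    then have "\<kappa> \<le> q" using q1 by (simp add: \<kappa>_def cos_arccos_abs)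
    then have "\<kappa> * R \<le> q * R" using R by (simp add: mult_right_mono)
    also have "q * R = - (\<nu> \<bullet> (z - \<zeta>))" using R n\<nu> by (simp add: q_def nz)
    finally have zn: "\<nu> \<bullet> (z - \<zeta>) \<le> - \<kappa> * R" by simp
    have xz: "norm (x - z) \<le> \<kappa> / 2 * R" using x by (simp add: R_def dist_norm)
    have "\<nu> \<bullet> (x - z) \<le> norm \<nu> * norm (x - z)" by (rule norm_cauchy_schwarz)
    then have xn: "\<nu> \<bullet> (x - \<zeta>) \<le> - (\<kappa> / 2) * R"
      using zn xz n\<nu> by (simp add: inner_diff_right)
    have "\<kappa> / 2 * R < 1 * R" using \<kappa> R by (intro mult_strict_right_mono) auto
    then have xR: "norm (x - \<zeta>) < 2 * R"
      using norm_triangle_ineq[of "x - z" "z - \<zeta>"] xz nz by simp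
    then have x12: "norm (x - \<zeta>) < r1" "x \<in> U"
      using z(2) r2(2) by (auto simp: R_def dist_norm norm_minus_commute)
    have "\<rho> x \<le> 2 * (g \<bullet> (x - \<zeta>)) + \<eta> * norm (x - \<zeta>)"
      using r1(2)[OF x12(1)] \<rho>0 by simp
    also have "\<dots> < 2 * (norm g * (- (\<kappa> / 2) * R)) + \<eta> * (2 * R)"
      unfolding g\<nu> using xn xR \<eta> by (intro add_le_less_mono mult_left_mono mult_strict_left_mono) auto
    also have "\<dots> = - (norm g * \<kappa> * R) / 2" by (simp add: \<eta>_def)
    also have "\<dots> \<le> 0" using \<kappa> R by simp
    finally show "x \<in> D" using x12(2) U(3) by blast
  qed
  show thesis
  proof (rule that[of "\<kappa> / 2" "min r1 r2 / 2"])
    show "0 < \<kappa> / 2" "0 < min r1 r2 / 2" using \<kappa> r1 r2 by auto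
    fix z assume z: "z \<in> cone_at \<zeta> (- unit_normal D \<zeta>) \<alpha>" "dist z \<zeta> < min r1 r2 / 2"
    note z' = z[folded \<nu>_def]
    have "z \<in> D" using main[OF z', of z] \<kappa> by simp
    moreover have "\<kappa> / 2 * dist z \<zeta> \<le> dist_bdry D z"
    proof -
      have ne: "frontier D \<noteq> {}" using \<zeta> by auto
      show ?thesis
        unfolding infdist_notempty[OF ne]
      proof (rule cINF_greatest[OF ne])
        fix p assume "p \<in> frontier D"
        then have "p \<notin> D" using oD by (simp add: frontier_def interior_open)
        then have "\<not> dist p z \<le> \<kappa> / 2 * dist z \<zeta>" using main[OF z'] by blast
        then show "\<kappa> / 2 * dist z \<zeta> \<le> dist z p" by (simp add: dist_commute)
      qed
    qed
    ultimately show "z \<in> D \<and> \<kappa> / 2 * dist z \<zeta> \<le> dist_bdry D z" ..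
  qed
qed

text \<open>The rotation by \<open>-1\<close> in a coordinate that vanishes at \<open>\<zeta>\<close> fixes \<open>\<zeta>\<close> and preserves \<open>D\<close>, but it
  would exchange an inward with an outward direction if the normal had a component there.\<close>

lemma reinhardt_grad_bar_zero:
  fixes D :: "(complex ^ 'n) set"
  assumes D: "reinhardt_domain D" and ldf: "local_defining_fun D \<zeta> U \<rho>" and \<zeta>: "\<zeta> \<in> frontier D"
    and j: "\<zeta> $ j = 0"
  shows "grad_bar \<rho> \<zeta> $ j = 0"
proof (rule ccontr)
  assume gj: "grad_bar \<rho> \<zeta> $ j \<noteq> 0"
  have oD: "open D" using D by (simp add: reinhardt_domain_def is_domain_def)
  define e where "e = axis j (grad_bar \<rho> \<zeta> $ j)"
  have ge: "0 < grad_bar \<rho> \<zeta> \<bullet> e" using gj by (simp add: e_def inner_axis)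
  have \<rho>0: "\<rho> \<zeta> = 0" by (rule local_defining_fun_zero[OF ldf oD \<zeta>])
  obtain d1 where d1: "d1 > 0" "\<And>t. 0 < t \<Longrightarrow> t < d1 \<Longrightarrow> 0 < \<rho> (\<zeta> + t *\<^sub>R e)"
    using DERIV_pos_inc_right[OF local_defining_fun_line_derivative[OF ldf, of e]] ge \<rho>0 by auto
  obtain d2 where d2: "d2 > 0" "\<And>t. 0 < t \<Longrightarrow> t < d2 \<Longrightarrow> \<rho> (\<zeta> - t *\<^sub>R e) < 0"
    using DERIV_pos_inc_left[OF local_defining_fun_line_derivative[OF ldf, of e]] ge \<rho>0 by auto
  have U: "open U" "\<zeta> \<in> U" "U \<inter> D = {z \<in> U. \<rho> z < 0}" using ldf by (auto simp: local_defining_fun_def)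
  obtain r where r: "0 < r" "ball \<zeta> r \<subseteq> U" using U open_contains_ball by blast
  have e0: "0 < norm e" using ge by auto
  define q where "q = r / norm e"
  have q: "0 < q" using r e0 by (simp add: q_def)
  define t where "t = min (min d1 d2) q / 2"
  have t: "0 < t" "t < d1" "t < d2" "t < q" using d1(1) d2(1) q by (auto simp: t_def)
  have "t * norm e < r" using t(4) e0 by (simp add: q_def pos_less_divide_eq)
  then have tU: "\<zeta> + t *\<^sub>R e \<in> U" "\<zeta> - t *\<^sub>R e \<in> U" using r(2) t(1) by (auto simp: dist_norm subset_iff)
  have "\<zeta> - t *\<^sub>R e \<in> D" using d2(2)[OF t(1) t(3)] tU U(3) by blast
  moreover have "cmod ((\<zeta> + t *\<^sub>R e) $ i) = cmod ((\<zeta> - t *\<^sub>R e) $ i)" for i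
    using j by (cases "i = j") (auto simp: e_def axis_def)
  ultimately have "\<zeta> + t *\<^sub>R e \<in> D" using reinhardt_same_modulus(1)[OF D] by blast
  then have "\<rho> (\<zeta> + t *\<^sub>R e) < 0" using tU U(3) by blast
  then show False using d1(2)[OF t(1) t(2)] by simp
qed

theorem theorem3:
  fixes D :: "(complex ^ 'n) set" and z0 \<zeta>0 :: "complex ^ 'n"
  assumes "reinhardt_domain D"
    and "pseudoconvex D"
    and "C1_smooth_domain D"
    and "z0 \<in> D"
    and "\<zeta>0 \<in> frontier D"
  shows "\<forall>\<alpha> U. 0 < \<alpha> \<and> \<alpha> < pi / 2 \<and> open U \<and> \<zeta>0 \<in> U \<and>
           U \<inter> cone_at \<zeta>0 (- unit_normal D \<zeta>0) \<alpha> \<subseteq> D \<longrightarrow>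
         (\<exists>C U'. open U' \<and> \<zeta>0 \<in> U' \<and> U' \<subseteq> U \<and>
            (\<forall>z \<in> U' \<inter> cone_at \<zeta>0 (- unit_normal D \<zeta>0) \<alpha>.
               kobayashi D z0 z \<ge> ereal (- (1 / 2) * ln (dist_bdry D z) + C)))"
proof (intro allI impI, elim conjE)
  fix \<alpha> U
  assume \<alpha>: "0 < \<alpha>" "\<alpha> < pi / 2" and U: "open U" "\<zeta>0 \<in> U"
  define K where "K = cone_at \<zeta>0 (- unit_normal D \<zeta>0) \<alpha>"
  have oD: "open D" using assms(1) by (simp add: reinhardt_domain_def is_domain_def)
  obtain V \<rho> where ldf: "local_defining_fun D \<zeta>0 V \<rho>"
    using assms(3,5) unfolding C1_smooth_domain_def by blast
  obtain c r1 where c: "0 < c" and r1: "0 < r1"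
    and cone: "\<And>z. z \<in> K \<Longrightarrow> dist z \<zeta>0 < r1 \<Longrightarrow> z \<in> D \<and> c * dist z \<zeta>0 \<le> dist_bdry D z"
    using defining_fun_cone_estimate[OF ldf oD assms(5) \<alpha>] unfolding K_def by metis
  define \<nu> where "\<nu> = unit_normal D \<zeta>0"
  have \<nu>: "\<nu> = grad_bar \<rho> \<zeta>0 /\<^sub>R norm (grad_bar \<rho> \<zeta>0)"
    unfolding \<nu>_def by (rule unit_normal_eq[OF ldf oD assms(5)])
  have "grad_bar \<rho> \<zeta>0 \<noteq> 0" using ldf by (auto simp: local_defining_fun_def)
  then have n\<nu>: "norm \<nu> = 1" by (simp add: \<nu>)
  \<comment> \<open>A point on the inward normal lies in the cone, at angle 0, hence in
    \<open>D\<close>. It vanishes wherever \<open>\<zeta>0\<close> does, because the normal has no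
    component there; \<open>reinhardt_peak_weights\<close> asks for such a point.\<close>
  define w where "w = \<zeta>0 - (r1 / 2) *\<^sub>R \<nu>"
  have "w \<in> K"
    using n\<nu> r1 \<alpha>(1) by (auto simp: K_def cone_at_def w_def \<nu>_def[symmetric] dot_square_norm)
  then have wD: "w \<in> D" using cone n\<nu> r1 by (auto simp: w_def dist_norm)
  have w0: "w $ j = 0" if "\<zeta>0 $ j = 0" for j
    using reinhardt_grad_bar_zero[OF assms(1) ldf assms(5) that] that by (simp add: w_def \<nu>)
  obtain a :: "real ^ 'n" where a: "\<And>j. \<zeta>0 $ j = 0 \<Longrightarrow> a $ j = 0"
    and a1: "\<And>j. 1 \<le> a $ j \<or> a $ j = 0 \<or> (\<forall>z\<in>D. z $ j \<noteq> 0)"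
    and lt1: "\<And>z. z \<in> D \<Longrightarrow> weighted_modulus a \<zeta>0 z < 1"
    using reinhardt_peak_weights[OF assms(1,2,5) wD w0] by metis
  obtain B r2 where B: "0 < B" and r2: "0 < r2"
    and bound: "\<And>z. dist z \<zeta>0 < r2 \<Longrightarrow> 1 - weighted_modulus a \<zeta>0 z \<le> B * dist z \<zeta>0"
    using weighted_modulus_boundary_bound[OF a] by metis
  define \<Theta> where "\<Theta> z = artanh (weighted_modulus a \<zeta>0 z)" for z
  have contr: "\<Theta> (f m) - \<Theta> (f l) \<le> poincare_dist l m"
    if f: "f \<in> holomorphic_discs D" and lm: "l \<in> ball 0 1" "m \<in> ball 0 1" for f l m
    unfolding \<Theta>_def weighted_modulus_def
  proof (rule artanh_weighted_prod_le_poincare_dist[where F = "\<lambda>j l. f l $ j / \<zeta>0 $ j"])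
    have fD: "f z \<in> D" if "z \<in> ball 0 1" for z using f that by (auto simp: holomorphic_discs_def)
    fix j assume j: "j \<in> {j. a $ j \<noteq> 0}"
    then have \<zeta>j: "\<zeta>0 $ j \<noteq> 0" using a by auto
    show "(\<lambda>l. f l $ j / \<zeta>0 $ j) holomorphic_on ball 0 1"
      using f \<zeta>j by (intro holomorphic_intros) (auto simp: holomorphic_discs_def)
    show "1 \<le> a $ j \<or> (\<forall>z\<in>ball 0 1. f z $ j / \<zeta>0 $ j \<noteq> 0)"
      using a1[of j] j \<zeta>j fD by auto
  next
    fix z :: complex assume "z \<in> ball 0 1"
    then have "f z \<in> D" using f by (auto simp: holomorphic_discs_def)
    then show "(\<Prod>j | a $ j \<noteq> 0. cmod (f z $ j / \<zeta>0 $ j) powr a $ j) < 1"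
      using lt1 by (simp add: weighted_modulus_def)
  qed (use lm in auto)
  \<comment> \<open>The first term comes from \<open>1 - \<phi> \<le> B / c * dist_bdry D z\<close>
    in the cone, the second from the base point.\<close>
  define C where "C = - (1 / 2) * ln (B / c) - \<Theta> z0"
  show "\<exists>C U'. open U' \<and> \<zeta>0 \<in> U' \<and> U' \<subseteq> U \<and>
      (\<forall>z \<in> U' \<inter> cone_at \<zeta>0 (- unit_normal D \<zeta>0) \<alpha>.
         kobayashi D z0 z \<ge> ereal (- (1 / 2) * ln (dist_bdry D z) + C))"
  proof (intro exI conjI ballI)
    show "open (U \<inter> ball \<zeta>0 (min r1 r2))" "\<zeta>0 \<in> U \<inter> ball \<zeta>0 (min r1 r2)"
      "U \<inter> ball \<zeta>0 (min r1 r2) \<subseteq> U"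
      using U r1 r2 by auto
    fix z assume "z \<in> U \<inter> ball \<zeta>0 (min r1 r2) \<inter> cone_at \<zeta>0 (- unit_normal D \<zeta>0) \<alpha>"
    then have z: "z \<in> K" "dist z \<zeta>0 < r1" "dist z \<zeta>0 < r2" by (auto simp: K_def dist_commute)
    have zD: "z \<in> D" and d: "c * dist z \<zeta>0 \<le> dist_bdry D z" using cone[OF z(1,2)] by auto
    define \<phi> where "\<phi> = weighted_modulus a \<zeta>0 z"
    have \<phi>: "0 \<le> \<phi>" "\<phi> < 1"
      using lt1[OF zD] by (auto simp: \<phi>_def weighted_modulus_def intro!: prod_nonneg)
    have "0 < dist z \<zeta>0" using z(1) by (simp add: K_def cone_at_def)
    then have dpos: "0 < dist_bdry D z" using d c by (smt (verit) mult_pos_pos)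
    have "1 - \<phi> \<le> B * dist z \<zeta>0" unfolding \<phi>_def by (rule bound[OF z(3)])
    also have "\<dots> \<le> B / c * dist_bdry D z"
      using d c B mult_left_mono[OF d, of "B / c"] by simp
    finally have "ln (1 - \<phi>) \<le> ln (B / c * dist_bdry D z)" using \<phi> by simp
    also have "\<dots> = ln (B / c) + ln (dist_bdry D z)" by (subst ln_mult) (use B c dpos in auto)
    finally have "- (1 / 2) * ln (dist_bdry D z) - (1 / 2) * ln (B / c) \<le> - (1 / 2) * ln (1 - \<phi>)" by simp
    also have "\<dots> \<le> \<Theta> z"
    proof -
      have "\<Theta> z = (ln (1 + \<phi>) - ln (1 - \<phi>)) / 2"
        using \<phi> by (simp add: \<Theta>_def \<phi>_def[symmetric] artanh_def ln_div)
      moreover have "0 \<le> ln (1 + \<phi>)" using \<phi> by simp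
      ultimately show ?thesis by simp
    qed
    finally have "ereal (- (1 / 2) * ln (dist_bdry D z) + C) \<le> ereal (\<Theta> z - \<Theta> z0)"
      by (simp add: C_def)
    also have "\<dots> \<le> kobayashi D z0 z" using contr by (rule kobayashi_ge)
    finally show "ereal (- (1 / 2) * ln (dist_bdry D z) + C) \<le> kobayashi D z0 z" .
  qed
qed

end
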